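(* Let $(M,\mathcal T)$ be a closed triangulated surface with inversive distance $I\ge 0$ in hyperbolic background geometry. For every $\bar K\in K(\Omega)=\{K(r)\mid r\in\Omega\}$ there is exactly one $\bar r\in\mathbb R^N_{>0}$ with $\widetilde K(\bar r)=\bar K$. As a consequence, if there exists a metric of zero curvature in $\Omega$ (i.e. $r^*\in\Omega$ with $K_i(r^* )=0$ for all $i\in V$), then it is the unique $r\in\mathbb R^N_{>0}$ with $\widetilde K(r)=0$.
   Context: Setting. $M$ is a closed surface with a triangulation $\mathcal T=\{V,E,F\}$ (vertices, edges, faces), with vertices numbered $1,\dots,N$. The inversive distance is a fixed function $I:E\to[0,+\infty)$, $\{ij\}\mapsto I_{ij}$. For $r=(r_1,\dots,r_N)\in\mathbb R^N_{>0}$, each edge $\{ij\}$ gets the hyperbolic length $l_{ij}=\cosh^{-1}(\cosh r_i\cosh r_j+I_{ij}\sinh r_i\sinh r_j)$. $\Omega$ is the set of $r\in\mathbb R^N_{>0}$ such that for every face $\{ijk\}\in F$ the lengths $l_{ij},l_{jk},l_{ik}$ satisfy the three strict triangle inequalities. For $r\in\Omega$, $\theta_i^{jk}$ is the inner angle at vertex $i$ of the hyperbolic triangle with edge lengths $l_{ij},l_{jk},l_{ik}$, and the discrete Gaussian curvature is $K_i(r)=2\pi-\sum_{\{ijk\}\in F}\theta_i^{jk}$ (sum over faces containing $i$); $K=(K_1,\dots,K_N)$. Extended curvature. For every $r\in\mathbb R^N_{>0}$ and face $\{ijk\}$, the generalized inner angles are: $\tilde\theta_i^{jk}=\theta_i^{jk}$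 (and similarly at $j,k$) if $l_{ij},l_{jk},l_{ik}$ satisfy the strict triangle inequalities; if one edge length is at least the sum of the other two, the generalized angle opposite to that edge is $\pi$ and the other two generalized angles are $0$. The extended curvature is $\widetilde K_i(r)=2\pi-\sum_{\{ijk\}\in F}\tilde\theta_i^{jk}$, a continuous function on $\mathbb R^N_{>0}$ that agrees with $K_i$ on $\Omega$; $\widetilde K=(\widetilde K_1,\dots,\widetilde K_N)$. *)

theory Defs
  imports "HOL-Analysis.Analysis"
begin

text \<open>Compact and locally Euclidean imply second countable, so that axiom is not listed.
  Connectedness is not part of the definition.\<close>

definition closed_surface :: "'m topology \<Rightarrow> bool" where
  "closed_surface M \<longleftrightarrow>
     compact_space M \<and> Hausdorff_space M \<and>
     (\<forall>x\<in>topspace M. \<exists>U. openin M U \<and> x \<in> U \<and>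
        subtopology M U homeomorphic_space (euclidean :: (real^2) topology))"

text \<open>Geometric realization, in barycentric coordinates, of the simplicial complex generated
  by a set \<open>F\<close> of faces.  The vertices are the elements of the index type \<open>'n\<close>, which plays
  the role of \<open>{1,\<dots>,N}\<close>.\<close>

definition realization :: "'n::finite set set \<Rightarrow> (real^'n) set" where
  "realization F =
     {x. (\<forall>i. 0 \<le> x $ i) \<and> (\<Sum>i\<in>UNIV. x $ i) = 1 \<and> (\<exists>f\<in>F. \<forall>i. i \<notin> f \<longrightarrow> x $ i = 0)}"

definition surface_triangulation :: "'m topology \<Rightarrow> 'n::finite set set \<Rightarrow> 'n set set \<Rightarrow> bool" where
  "surface_triangulation M E F \<longleftrightarrow>
     (\<forall>f\<in>F. card f = 3) \<and> \<Union>F = UNIV \<and>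
     E = {e. card e = 2 \<and> (\<exists>f\<in>F. e \<subseteq> f)} \<and>
     top_of_set (realization F) homeomorphic_space M"

text \<open>The hyperboloid model of the hyperbolic plane.\<close>

definition mink :: "real^3 \<Rightarrow> real^3 \<Rightarrow> real" where
  "mink x y = x $ 1 * y $ 1 + x $ 2 * y $ 2 - x $ 3 * y $ 3"

definition hplane :: "(real^3) set" where
  "hplane = {x. mink x x = - 1 \<and> 0 < x $ 3}"

definition hdist :: "real^3 \<Rightarrow> real^3 \<Rightarrow> real" where
  "hdist p q = arcosh (- mink p q)"

text \<open>\<open>hdir p q\<close> is the component of \<open>q\<close> tangent to the hyperboloid at \<open>p\<close>; it is a positive
  multiple of the initial velocity of the geodesic from \<open>p\<close> to \<open>q\<close>.  \<open>mink\<close> is positive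
  definite on tangent spaces.\<close>

definition hdir :: "real^3 \<Rightarrow> real^3 \<Rightarrow> real^3" where
  "hdir p q = q + mink p q *\<^sub>R p"

definition hangle :: "real^3 \<Rightarrow> real^3 \<Rightarrow> real^3 \<Rightarrow> real" where
  "hangle p q s =
     arccos (mink (hdir p q) (hdir p s) /
             (sqrt (mink (hdir p q) (hdir p q)) * sqrt (mink (hdir p s) (hdir p s))))"

definition pos_radii :: "(real^'n) set" where
  "pos_radii = {r. \<forall>i. 0 < r $ i}"

definition edge_length :: "('n set \<Rightarrow> real) \<Rightarrow> real^'n \<Rightarrow> 'n \<Rightarrow> 'n \<Rightarrow> real" where
  "edge_length I r i j =
     arcosh (cosh (r $ i) * cosh (r $ j) + I {i, j} * sinh (r $ i) * sinh (r $ j))"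

text \<open>The quantifier ranges over all orderings of the three vertices of \<open>f\<close>, so this comprises all
  three triangle inequalities.\<close>

definition nondegenerate :: "('n set \<Rightarrow> real) \<Rightarrow> real^'n \<Rightarrow> 'n set \<Rightarrow> bool" where
  "nondegenerate I r f \<longleftrightarrow>
     (\<forall>i j k. f = {i, j, k} \<longrightarrow>
        edge_length I r j k < edge_length I r i j + edge_length I r i k)"

definition Omega :: "'n set set \<Rightarrow> ('n set \<Rightarrow> real) \<Rightarrow> (real^'n) set" where
  "Omega F I = {r \<in> pos_radii. \<forall>f\<in>F. nondegenerate I r f}"

text \<open>The angle at \<open>i\<close> of a hyperbolic triangle \<open>p\<close> with vertices labelled by the face \<open>f\<close> and
  the prescribed edge lengths; existence and uniqueness are proved in
  \<open>inner_angle_eq\<close> below.\<close>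

definition inner_angle :: "('n set \<Rightarrow> real) \<Rightarrow> real^'n \<Rightarrow> 'n set \<Rightarrow> 'n \<Rightarrow> real" where
  "inner_angle I r f i =
     (THE t. \<exists>p j k. f = {i, j, k} \<and> p ` f \<subseteq> hplane \<and>
        (\<forall>v\<in>f. \<forall>w\<in>f. v \<noteq> w \<longrightarrow> hdist (p v) (p w) = edge_length I r v w) \<and>
        t = hangle (p i) (p j) (p k))"

definition gen_inner_angle :: "('n set \<Rightarrow> real) \<Rightarrow> real^'n \<Rightarrow> 'n set \<Rightarrow> 'n \<Rightarrow> real" where
  "gen_inner_angle I r f i =
     (if nondegenerate I r f then inner_angle I r f i
      else if \<exists>j k. f = {i, j, k} \<and>
                edge_length I r j k \<ge> edge_length I r i j + edge_length I r i k
      then pi else 0)"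

definition curvature :: "'n set set \<Rightarrow> ('n set \<Rightarrow> real) \<Rightarrow> real^'n::finite \<Rightarrow> real^'n" where
  "curvature F I r = (\<chi> i. 2 * pi - (\<Sum>f\<in>{f \<in> F. i \<in> f}. inner_angle I r f i))"

definition ext_curvature :: "'n set set \<Rightarrow> ('n set \<Rightarrow> real) \<Rightarrow> real^'n::finite \<Rightarrow> real^'n" where
  "ext_curvature F I r = (\<chi> i. 2 * pi - (\<Sum>f\<in>{f \<in> F. i \<in> f}. gen_inner_angle I r f i))"

lemma mink_commute: "mink x y = mink y x"
  by (simp add: mink_def)

lemma mink_hplane_le:
  assumes "p \<in> hplane" "q \<in> hplane"
  shows "mink p q \<le> - 1"
proof -
  have p: "(p$3)^2 = 1 + (p$1)^2 + (p$2)^2" "0 < p$3"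
    and q: "(q$3)^2 = 1 + (q$1)^2 + (q$2)^2" "0 < q$3"
    using assms by (auto simp: hplane_def mink_def power2_eq_square)
  have "(p$3 * q$3)^2 - (1 + p$1 * q$1 + p$2 * q$2)^2
      = (p$1 - q$1)^2 + (p$2 - q$2)^2 + (p$1 * q$2 - p$2 * q$1)^2"
    unfolding power_mult_distrib p(1) q(1) by (simp add: power2_eq_square algebra_simps)
  then have "(1 + p$1 * q$1 + p$2 * q$2)^2 \<le> (p$3 * q$3)^2"
    by (smt (verit) zero_le_power2)
  then have "1 + p$1 * q$1 + p$2 * q$2 \<le> p$3 * q$3"
    by (rule power2_le_imp_le) (use p q in simp)
  then show ?thesis by (simp add: mink_def)
qed

lemma mink_eq_cosh_hdist:
  assumes "p \<in> hplane" "q \<in> hplane"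
  shows "mink p q = - cosh (hdist p q)" and "0 \<le> hdist p q"
  using mink_hplane_le[OF assms] by (auto simp: hdist_def)

text \<open>The hyperbolic law of cosines.\<close>

lemma hangle_eq:
  assumes "p \<in> hplane" "q \<in> hplane" "s \<in> hplane"
  shows "hangle p q s =
    arccos ((cosh (hdist p q) * cosh (hdist p s) - cosh (hdist q s)) /
            (sinh (hdist p q) * sinh (hdist p s)))"
proof -
  have pp: "mink p p = - 1" and qq: "mink q q = - 1" and ss: "mink s s = - 1"
    using assms by (auto simp: hplane_def)
  have ex: "mink (hdir p x) (hdir p y) = mink x y + mink p x * mink p y" for x y
  proof -
    have "mink (hdir p x) (hdir p y)
        = mink x y + 2 * mink p x * mink p y + mink p x * mink p y * mink p p"
      by (simp add: mink_def hdir_def algebra_simps)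
    then show ?thesis by (simp add: pp)
  qed
  have sq: "sqrt (cosh d * cosh d - 1) = sinh d" if "0 \<le> d" for d :: real
    using that by (simp add: cosh_square_eq[of d, unfolded power2_eq_square] real_sqrt_mult_self)
  show ?thesis
    unfolding hangle_def ex qq ss
    using mink_eq_cosh_hdist[of p q] mink_eq_cosh_hdist[of p s] mink_eq_cosh_hdist[of q s] assms
    by (simp add: sq add.commute)
qed

lemma hyperbolic_triangle_exists:
  fixes a b c :: real
  assumes "a < b + c" "b < a + c" "c < a + b"
  shows "\<exists>p\<in>hplane. \<exists>q\<in>hplane. \<exists>s\<in>hplane. hdist q s = a \<and> hdist p s = b \<and> hdist p q = c"
proof -
  have pos: "0 < a" "0 < b" "0 < c" using assms by auto
  define x where "x = (cosh b * cosh c - cosh a) / (sinh b * sinh c)"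
  have sb: "0 < sinh b * sinh c" using pos by simp
  have "cosh a < cosh (b + c)"
    using assms pos by (simp add: cosh_real_nonneg_less_iff)
  then have x1: "- 1 \<le> x" using sb by (simp add: x_def cosh_add field_simps)
  have "cosh \<bar>b - c\<bar> < cosh a"
    using assms pos by (subst cosh_real_nonneg_less_iff) auto
  then have x2: "x \<le> 1" using sb by (simp add: x_def cosh_diff field_simps)
  have xx: "x * x \<le> 1" using x1 x2 abs_square_le_1[of x] by (simp add: power2_eq_square)
  have ch: "cosh t * cosh t = 1 + sinh t * sinh t" for t :: real
    using cosh_square_eq[of t] by (simp add: power2_eq_square)
  define p :: "real^3" where "p = vector [0, 0, 1]"
  define q :: "real^3" where "q = vector [sinh c, 0, cosh c]"
  define s :: "real^3" where "s = vector [sinh b * x, sinh b * sqrt (1 - x * x), cosh b]"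
  have "mink s s = sinh b * sinh b * (x * x + sqrt (1 - x * x) * sqrt (1 - x * x)) - cosh b * cosh b"
    by (simp add: mink_def s_def algebra_simps)
  then have s: "s \<in> hplane"
    using xx by (simp add: hplane_def ch s_def cosh_real_pos)
  have pq: "p \<in> hplane" "q \<in> hplane"
    by (simp_all add: hplane_def mink_def p_def q_def ch cosh_real_pos)
  have "sinh c * (sinh b * x) = cosh b * cosh c - cosh a"
    using sb pos by (simp add: x_def)
  then have "mink q s = - cosh a" by (simp add: mink_def q_def s_def)
  moreover have "mink p s = - cosh b" "mink p q = - cosh c"
    by (simp_all add: mink_def p_def q_def s_def)
  ultimately show ?thesis
    using s pq pos by (intro bexI[of _ p] bexI[of _ q] bexI[of _ s]) (simp_all add: hdist_def arcosh_cosh_real)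
qed

lemma edge_length_commute: "edge_length I r i j = edge_length I r j i"
  by (simp add: edge_length_def insert_commute mult.commute mult.left_commute)

lemma inner_angle_eq:
  fixes i j k :: "'n::finite" and r :: "real^'n"
  assumes f: "f = {i, j, k}" and d: "i \<noteq> j" "i \<noteq> k" "j \<noteq> k" and nd: "nondegenerate I r f"
  defines "a \<equiv> edge_length I r j k"
    and "b \<equiv> edge_length I r i k"
    and "c \<equiv> edge_length I r i j"
  shows "inner_angle I r f i =
    arccos ((cosh b * cosh c - cosh a) / (sinh b * sinh c))"
  unfolding inner_angle_def
proof (rule the_equality)
  have "a < b + c" "b < a + c" "c < a + b"
  proof -
    have N: "edge_length I r w v < edge_length I r u w + edge_length I r u v"
      if "f = {u, w, v}" for u v w
      using nd that unfolding nondegenerate_def by blast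
    have "f = {j, i, k}" "f = {k, i, j}" using f by auto
    from N[OF f] N[OF this(1)] N[OF this(2)]
    show "a < b + c" "b < a + c" "c < a + b"
      unfolding a_def b_def c_def
      by (simp_all add: add.commute edge_length_commute[of I r j i] edge_length_commute[of I r k i]
          edge_length_commute[of I r k j])
  qed
  then obtain p q s where pqs: "p \<in> hplane" "q \<in> hplane" "s \<in> hplane"
    "hdist q s = a" "hdist p s = b" "hdist p q = c"
    using hyperbolic_triangle_exists by blast
  define P where "P = (\<lambda>v. if v = i then p else if v = j then q else s)"
  have P: "P i = p" "P j = q" "P k = s" using d by (auto simp: P_def)
  have sym: "hdist x y = hdist y x" for x y by (simp add: hdist_def mink_commute)
  show "\<exists>p j' k'. f = {i, j', k'} \<and> p ` f \<subseteq> hplane \<and>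
        (\<forall>v\<in>f. \<forall>w\<in>f. v \<noteq> w \<longrightarrow> hdist (p v) (p w) = edge_length I r v w) \<and>
        arccos ((cosh b * cosh c - cosh a) / (sinh b * sinh c)) = hangle (p i) (p j') (p k')"
  proof (rule exI[of _ P], rule exI[of _ j], rule exI[of _ k], intro conjI)
    show "\<forall>v\<in>f. \<forall>w\<in>f. v \<noteq> w \<longrightarrow> hdist (P v) (P w) = edge_length I r v w"
      unfolding f using pqs d
      by (simp add: P a_def b_def c_def sym[of s q] sym[of s p] sym[of q p]
          edge_length_commute[of I r k i] edge_length_commute[of I r k j] edge_length_commute[of I r j i])
    show "arccos ((cosh b * cosh c - cosh a) / (sinh b * sinh c)) = hangle (P i) (P j) (P k)"
      using pqs by (simp add: P hangle_eq mult.commute)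
  qed (use f P pqs in auto)
next
  fix t
  assume "\<exists>p j k. f = {i, j, k} \<and> p ` f \<subseteq> hplane \<and>
        (\<forall>v\<in>f. \<forall>w\<in>f. v \<noteq> w \<longrightarrow> hdist (p v) (p w) = edge_length I r v w) \<and>
        t = hangle (p i) (p j) (p k)"
  then obtain p j' k' where 1: "f = {i, j', k'}" "p ` f \<subseteq> hplane"
    "\<And>v w. v \<in> f \<Longrightarrow> w \<in> f \<Longrightarrow> v \<noteq> w \<Longrightarrow> hdist (p v) (p w) = edge_length I r v w"
    "t = hangle (p i) (p j') (p k')" by blast
  have jk: "j' = j \<and> k' = k \<or> j' = k \<and> k' = j"
    using 1(1) f d by (auto simp: insert_eq_iff doubleton_eq_iff)
  have h: "p i \<in> hplane" "p j \<in> hplane" "p k \<in> hplane" using 1(2) f by auto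
  have "hdist (p j) (p k) = a" "hdist (p k) (p j) = a" "hdist (p i) (p k) = b" "hdist (p i) (p j) = c"
    using 1(3)[of j k] 1(3)[of k j] 1(3)[of i k] 1(3)[of i j] f d
    by (simp_all add: a_def b_def c_def edge_length_commute[of I r k j])
  then show "t = arccos ((cosh b * cosh c - cosh a) / (sinh b * sinh c))"
    using jk 1(4) h by (elim disjE) (simp_all add: hangle_eq mult.commute)
qed

end

theory Submission
  imports Defs
begin

text \<open>
  A given curvature is attained at a point of \<open>Omega\<close>, where the extended curvature is the curvature,
  so the content is uniqueness: if \<open>r \<in> Omega\<close> and \<open>s\<close> is any vector of positive radii with the same
  extended curvature, then \<open>s = r\<close> (\<open>ext_curvature_rigid\<close>).

  In the variables \<open>w\<^sub>i = - ln (tanh (r\<^sub>i / 2))\<close>, which range over the positive reals, the map from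
  \<open>w\<close> to the generalized angles of one face is monotone: the inner product of the difference of the
  angle vectors with the difference of the variables is nonnegative, and positive if the two points
  differ and one of them gives a nondegenerate triangle (\<open>face_angles_monotone\<close>).  The sum over all
  faces is minus the inner product of the difference of the curvatures with the difference of the
  variables.  It is positive if \<open>r \<noteq> s\<close>, since each vertex belongs to some face and all faces are
  nondegenerate for \<open>r\<close>; so the curvatures at \<open>r\<close> and \<open>s\<close> differ.

  Monotonicity is usually derived from a convex potential whose gradient is given by the angles.  Here it
  is proved along the segment between the two points, for the function \<open>g\<close> that pairs the angles
  with the direction of the segment.  It is continuous.  At a degenerate triangle all angles are \<open>0\<close> or
  \<open>\<pi>\<close>, so \<open>g\<close> takes one of finitely many values; at a nondegenerate triangle its derivative is positive.
  A continuous function with these two properties is nondecreasing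
  (\<open>mono_if_pos_deriv_off_finite\<close>).

  The derivative is positive because the Jacobian of the angles in the variables \<open>- w\<close> is negative
  definite on nondegenerate triangles (\<open>edge_form_negative_definite\<close>).  Up to a positive factor it is
  a weighted graph Laplacian of the triangle with a negative diagonal correction, and it would be
  visibly negative definite if all weights were positive, which can fail for inversive distances greater
  than 1.  But for a fixed triangle the weights depend linearly on the numbers \<open>c\<^sub>i = cosh r\<^sub>i\<close>, and
  the form is nonsingular on the convex cone of those \<open>c\<close> for which each edge grows with the circles
  at its ends (\<open>edge_form_inj\<close>).  For \<open>I \<ge> 0\<close> the radii give a point of this cone.  The incentre of the
  triangle gives another one, and there all weights are positive (\<open>incentre_weights\<close>).  A linear pencil of
  symmetric maps that never becomes singular keeps its signature (\<open>negative_definite_pencil\<close>).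
\<close>

section \<open>Two general criteria\<close>

text \<open>If \<open>g\<close> decreased, it would pass downwards through a level \<open>y\<close> outside the finite set \<open>V\<close>.
  At the last time with \<open>g \<ge> y\<close> the value is exactly \<open>y\<close>, so the derivative there is positive and
  \<open>g\<close> exceeds \<open>y\<close> a little later.\<close>

lemma mono_if_pos_deriv_off_finite:
  fixes g :: "real \<Rightarrow> real"
  assumes "a \<le> b" and cont: "continuous_on {a..b} g" and fin: "finite V"
    and alt: "\<And>t. t \<in> {a..b} \<Longrightarrow> g t \<in> V \<or> (\<exists>D>0. DERIV g t :> D)"
  shows "g a \<le> g b"
proof (rule ccontr)
  assume "\<not> g a \<le> g b"
  then have lt: "g b < g a" by simp
  then have "infinite ({g b<..<g a} - V)" using fin by (simp add: Diff_infinite_finite)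
  then obtain y where y: "g b < y" "y < g a" "y \<notin> V"
    by (metis Diff_iff finite.emptyI greaterThanLessThan_iff equals0I)
  define T where "T = {t \<in> {a..b}. y \<le> g t}"
  have "closed T" unfolding T_def
    using continuous_closed_preimage[OF cont, of "{y..}"] by (simp add: vimage_def Int_def)
  moreover have "bounded T" unfolding T_def by (rule bounded_subset[of "{a..b}"]) auto
  ultimately have "compact T" by (simp add: compact_eq_bounded_closed)
  moreover have "a \<in> T" using y \<open>a \<le> b\<close> by (simp add: T_def)
  ultimately obtain s where s: "s \<in> T" "\<And>t. t \<in> T \<Longrightarrow> t \<le> s"
    using compact_attains_sup[of T] by auto
  have sab: "a \<le> s" "s \<le> b" "y \<le> g s" using s(1) by (auto simp: T_def)
  have "\<exists>t\<ge>s. t \<le> b \<and> g t = y"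
    by (rule IVT2') (use sab y in \<open>auto intro: continuous_on_subset[OF cont]\<close>)
  then obtain t where t: "s \<le> t" "t \<le> b" "g t = y" by blast
  then have "t = s" using s(2)[of t] sab by (auto simp: T_def)
  with t have gs: "g s = y" by simp
  then obtain D where D: "D > 0" "DERIV g s :> D" using alt[of s] sab y by auto
  obtain d where d: "d > 0" "\<And>h. 0 < h \<Longrightarrow> h < d \<Longrightarrow> g s < g (s + h)"
    using DERIV_pos_inc_right[OF D(2,1)] by auto
  have sb: "s < b" using gs y sab by (metis less_le)
  define h where "h = min (d/2) (b - s)"
  have h: "0 < h" "h < d" "s + h \<le> b" using d sb by (auto simp: h_def)
  then have "s + h \<in> T" using d(2)[of h] gs sab by (auto simp: T_def)
  then show False using s(2)[of "s + h"] h by simp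
qed

text \<open>If \<open>f\<close> were not negative definite, the largest value \<open>c\<close> of the quotient
  \<open>(v \<bullet> f v) / - (v \<bullet> g v)\<close> would be nonnegative.  Then \<open>f + c g\<close> is negative semidefinite and its
  form vanishes at a maximizer, so the maximizer lies in the kernel of \<open>f + c g\<close>.\<close>

lemma negative_definite_pencil:
  fixes f g :: "'a::euclidean_space \<Rightarrow> 'a"
  assumes f: "linear f" "\<And>u v. u \<bullet> f v = f u \<bullet> v"
    and g: "linear g" "\<And>u v. u \<bullet> g v = g u \<bullet> v"
    and neg: "\<And>v. v \<noteq> 0 \<Longrightarrow> v \<bullet> g v < 0"
    and inj: "\<And>c v. 0 \<le> c \<Longrightarrow> f v + c *\<^sub>R g v = 0 \<Longrightarrow> v = 0"
    and "v \<noteq> 0"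
  shows "v \<bullet> f v < 0"
proof (rule ccontr)
  assume "\<not> v \<bullet> f v < 0"
  then have v: "0 \<le> v \<bullet> f v" by simp
  define \<rho> where "\<rho> = (\<lambda>u. (u \<bullet> f u) / - (u \<bullet> g u))"
  let ?S = "sphere (0::'a) 1"
  have nz: "u \<noteq> 0" if "u \<in> ?S" for u using that by auto
  have "continuous_on ?S \<rho>" unfolding \<rho>_def
    by (intro continuous_intros linear_continuous_on linear_conv_bounded_linear[THEN iffD1] f g)
       (use neg nz in force)
  moreover have sv: "v /\<^sub>R norm v \<in> ?S" using \<open>v \<noteq> 0\<close> by simp
  ultimately obtain e where e: "e \<in> ?S" "\<And>u. u \<in> ?S \<Longrightarrow> \<rho> u \<le> \<rho> e"
    using continuous_attains_sup[of ?S \<rho>] compact_sphere by (metis empty_iff)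
  have scale: "\<rho> (u /\<^sub>R norm u) = \<rho> u" if "u \<noteq> 0" for u
    using that by (simp add: \<rho>_def linear_scale[OF f(1)] linear_scale[OF g(1)] field_simps)
  have max: "\<rho> u \<le> \<rho> e" if "u \<noteq> 0" for u
    using e(2)[of "u /\<^sub>R norm u"] scale[OF that] that by simp
  define c where "c = \<rho> e"
  have "0 \<le> \<rho> v" using v neg[OF \<open>v \<noteq> 0\<close>] by (simp add: \<rho>_def divide_nonneg_neg)
  then have c: "0 \<le> c" using max[OF \<open>v \<noteq> 0\<close>] by (simp add: c_def)
  define k where "k = (\<lambda>u. f u + c *\<^sub>R g u)"
  have k_add: "k (u + t *\<^sub>R w) = k u + t *\<^sub>R k w" for u w t
    by (simp add: k_def linear_add[OF f(1)] linear_scale[OF f(1)] linear_add[OF g(1)]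
        linear_scale[OF g(1)] algebra_simps)
  have k_sym: "u \<bullet> k w = k u \<bullet> w" for u w
    by (simp add: k_def inner_add_left inner_add_right f g)
  have semi: "u \<bullet> k u \<le> 0" for u
  proof (cases "u = 0")
    case False
    then have "(u \<bullet> f u) / - (u \<bullet> g u) \<le> c" using max by (simp add: c_def \<rho>_def)
    then have "u \<bullet> f u \<le> c * - (u \<bullet> g u)"
      using neg[OF False] by (subst (asm) pos_divide_le_eq) auto
    then show ?thesis by (simp add: k_def inner_add_right)
  qed simp
  have e0: "e \<bullet> k e = 0"
    using neg[OF nz[OF e(1)]] by (simp add: k_def c_def \<rho>_def inner_add_right inner_diff_right)
  define w where "w = k e"
  \<comment> \<open>Moving from \<open>e\<close> a little in the direction \<open>w = k e\<close> raises the form at first order by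
    \<open>2 t (w \<bullet> w)\<close>; this \<open>t\<close> is small enough for the second-order term not to compensate.\<close>
  define t where "t = (w \<bullet> w) / (\<bar>w \<bullet> k w\<bar> + 1)"
  have "(e + t *\<^sub>R w) \<bullet> k (e + t *\<^sub>R w) = t * (2 * (w \<bullet> w) + t * (w \<bullet> k w))"
    unfolding k_add using k_sym[of e w] e0
    by (simp add: inner_add_left inner_add_right w_def algebra_simps)
  then have 1: "t * (2 * (w \<bullet> w) + t * (w \<bullet> k w)) \<le> 0" using semi[of "e + t *\<^sub>R w"] by simp
  have "w = 0"
  proof (rule ccontr)
    assume "w \<noteq> 0"
    then have p: "0 < w \<bullet> w" by simp
    then have t: "0 < t" by (simp add: t_def)
    have "t * \<bar>w \<bullet> k w\<bar> \<le> w \<bullet> w"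
      using p by (simp add: t_def field_simps)
    moreover have "- (t * \<bar>w \<bullet> k w\<bar>) \<le> t * (w \<bullet> k w)"
      using mult_left_mono[of "- \<bar>w \<bullet> k w\<bar>" "w \<bullet> k w" t] t by simp
    ultimately have "0 < 2 * (w \<bullet> w) + t * (w \<bullet> k w)" using p by linarith
    then show False using 1 t by (simp add: mult_le_0_iff)
  qed
  then have "e = 0" using inj[OF c, of e] by (simp add: w_def k_def)
  then show False using nz[OF e(1)] by simp
qed

section \<open>Generalized angles of a hyperbolic triangle\<close>

text \<open>The determinant of the symmetric matrix with unit diagonal and off-diagonal entries
  \<open>x\<close>, \<open>y\<close>, \<open>z\<close>.  For the hyperbolic cosines of three positive lengths it is positive exactly when
  the strict triangle inequalities hold.\<close>

definition gram :: "real \<Rightarrow> real \<Rightarrow> real \<Rightarrow> real" where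
  "gram x y z = 1 + 2 * x * y * z - x\<^sup>2 - y\<^sup>2 - z\<^sup>2"

text \<open>The generalized angle opposite to \<open>x\<close>, from the hyperbolic law of cosines; the arguments are
  the hyperbolic cosines of the edges.  The quotient is at most \<open>- 1\<close> when the opposite edge is too
  long and at least \<open>1\<close> when an adjacent edge is too long, so truncating it to \<open>[- 1, 1]\<close> yields the
  values \<open>\<pi>\<close> and \<open>0\<close> of the extension, and continuity comes for free.\<close>

definition tri_angle :: "real \<Rightarrow> real \<Rightarrow> real \<Rightarrow> real" where
  "tri_angle x y z = arccos (max (- 1) (min 1 ((y * z - x) / sqrt ((y\<^sup>2 - 1) * (z\<^sup>2 - 1)))))"

lemma gram_rotate: "gram y z x = gram x y z" "gram z x y = gram x y z"
  by (simp_all add: gram_def algebra_simps)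

lemma gram_eq: "gram x y z = (y\<^sup>2 - 1) * (z\<^sup>2 - 1) - (y * z - x)\<^sup>2"
  by (simp add: gram_def power2_eq_square algebra_simps)

lemma square_gt_1: "1 < x \<Longrightarrow> 0 < x\<^sup>2 - (1::real)"
  by (simp add: one_less_power)

lemma abs_cos_less_1_iff:
  assumes "1 < y" "1 < z"
  shows "\<bar>(y * z - x) / sqrt ((y\<^sup>2 - 1) * (z\<^sup>2 - 1))\<bar> < 1 \<longleftrightarrow> 0 < gram x y z"
proof -
  let ?d = "(y\<^sup>2 - 1) * (z\<^sup>2 - 1)"
  have d: "0 < ?d" using assms by (intro mult_pos_pos square_gt_1)
  have "\<bar>(y * z - x) / sqrt ?d\<bar> < 1 \<longleftrightarrow> \<bar>y * z - x\<bar> < sqrt ?d"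
    using d by (simp add: abs_divide field_simps)
  also have "\<dots> \<longleftrightarrow> (y * z - x)\<^sup>2 < ?d"
    using real_sqrt_less_iff[of "(y * z - x)\<^sup>2" ?d] by simp
  finally show ?thesis by (simp add: gram_eq)
qed

lemma tri_angle_degenerate:
  assumes "1 < y" "1 < z" "gram x y z \<le> 0"
  shows "tri_angle x y z \<in> {0, pi}"
proof -
  define p where "p = (y * z - x) / sqrt ((y\<^sup>2 - 1) * (z\<^sup>2 - 1))"
  have "p \<le> -1 \<or> 1 \<le> p" using abs_cos_less_1_iff[OF assms(1,2), of x] assms(3)
    unfolding p_def[symmetric] by linarith
  then show ?thesis unfolding tri_angle_def p_def[symmetric]
    by (auto simp: min_def max_def)
qed

lemma continuous_on_tri_angle:
  assumes "continuous_on S x" "continuous_on S y" "continuous_on S z"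
    and "\<And>t. t \<in> S \<Longrightarrow> 1 < y t" "\<And>t. t \<in> S \<Longrightarrow> 1 < z t"
  shows "continuous_on S (\<lambda>t. tri_angle (x t) (y t) (z t))"
proof -
  have "(y t)\<^sup>2 - 1 \<noteq> 0" "(z t)\<^sup>2 - 1 \<noteq> 0" if "t \<in> S" for t
    using square_gt_1[OF assms(4)[OF that]] square_gt_1[OF assms(5)[OF that]] by auto
  then show ?thesis unfolding tri_angle_def
    by (intro continuous_intros assms) auto
qed

lemma DERIV_tri_angle:
  assumes "(x has_real_derivative x') (at t)" "(y has_real_derivative y') (at t)"
    "(z has_real_derivative z') (at t)"
    and gt: "1 < y t" "1 < z t" and pos: "0 < gram (x t) (y t) (z t)"
  shows "((\<lambda>s. tri_angle (x s) (y s) (z s)) has_real_derivative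
      (x' - (x t * y t - z t) / ((y t)\<^sup>2 - 1) * y' - (x t * z t - y t) / ((z t)\<^sup>2 - 1) * z')
        / sqrt (gram (x t) (y t) (z t))) (at t)"
proof -
  \<comment> \<open>\<open>p\<close> is the cosine of the angle; \<open>d\<close> is the product of the \<open>sinh\<close> of the adjacent edges.\<close>
  define p where "p = (\<lambda>s. (y s * z s - x s) / sqrt (((y s)\<^sup>2 - 1) * ((z s)\<^sup>2 - 1)))"
  define Y Z d where "Y = (y t)\<^sup>2 - 1" and "Z = (z t)\<^sup>2 - 1" and "d = sqrt (Y * Z)"
  have YZ: "0 < Y" "0 < Z" using gt by (auto simp: Y_def Z_def intro: square_gt_1)
  have d: "0 < d" "d * d = Y * Z" using YZ by (auto simp: d_def)
  let ?A = "sqrt (gram (x t) (y t) (z t))"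
  let ?P' = "2 * y t * y' * Z + 2 * z t * z' * Y"
  define p' where "p' = ((y' * z t + z' * y t - x') * d
     - (y t * z t - x t) * (inverse d / 2 * ?P')) / (d * d)"
  have dd: "sqrt (((y t)\<^sup>2 - 1) * ((z t)\<^sup>2 - 1)) = d" by (simp add: d_def Y_def Z_def)
  have num: "((\<lambda>s. y s * z s - x s) has_real_derivative y' * z t + z' * y t - x') (at t)"
    by (intro DERIV_diff DERIV_mult assms)
  have "((\<lambda>s. ((y s)\<^sup>2 - 1) * ((z s)\<^sup>2 - 1)) has_real_derivative ?P') (at t)"
    unfolding Y_def Z_def by (auto intro!: derivative_eq_intros assms)
  from DERIV_chain2[OF DERIV_real_sqrt this] YZ
  have den: "((\<lambda>s. sqrt (((y s)\<^sup>2 - 1) * ((z s)\<^sup>2 - 1))) has_real_derivative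
      inverse d / 2 * ?P') (at t)"
    by (simp add: d_def Y_def Z_def)
  have p': "(p has_real_derivative p') (at t)"
    using DERIV_divide[OF num den] d(1) unfolding p_def p'_def dd by blast
  have lt: "\<bar>p t\<bar> < 1" using abs_cos_less_1_iff[OF gt] pos by (simp add: p_def)
  \<comment> \<open>Near \<open>p t\<close> the truncation is the identity.\<close>
  have "((\<lambda>q. arccos (max (- 1) (min 1 q))) has_real_derivative inverse (- sqrt (1 - (p t)\<^sup>2))) (at (p t))"
    by (rule has_field_derivative_transform_within_open[where S = "{-1<..<1}", OF DERIV_arccos])
      (use lt in auto)
  from DERIV_chain2[OF this p']
  have 1: "((\<lambda>s. tri_angle (x s) (y s) (z s)) has_real_derivative
      inverse (- sqrt (1 - (p t)\<^sup>2)) * p') (at t)"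
    by (simp add: tri_angle_def p_def)
  have "(p t)\<^sup>2 = (y t * z t - x t)\<^sup>2 / (Y * Z)"
    using d YZ by (simp add: p_def Y_def Z_def power_divide)
  then have "1 - (p t)\<^sup>2 = gram (x t) (y t) (z t) / (Y * Z)"
    using YZ by (simp add: gram_eq field_simps Y_def[symmetric] Z_def[symmetric])
  then have root: "sqrt (1 - (p t)\<^sup>2) = ?A / d"
    by (simp add: d_def real_sqrt_divide)
  have chain: "- d * p' = x' - (x t * y t - z t) / Y * y' - (x t * z t - y t) / Z * z'"
  proof -
    have "d * p' = (y' * z t + z' * y t - x')
       - (y t * z t - x t) * ((y t * y' * Z + z t * z' * Y) / (d * d))"
      using d(1) by (simp add: p'_def field_simps)
    also have "\<dots> = (y' * z t + z' * y t - x')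
       - (y t * z t - x t) * (y t * y' / Y + z t * z' / Z)"
      using YZ by (simp add: d(2) field_simps)
    also have "\<dots> = y' * (z t * Y - (y t * z t - x t) * y t) / Y
         + z' * (y t * Z - (y t * z t - x t) * z t) / Z - x'"
      using YZ by (simp add: field_simps)
    also have "z t * Y - (y t * z t - x t) * y t = x t * y t - z t"
      by (simp add: Y_def power2_eq_square algebra_simps)
    also have "y t * Z - (y t * z t - x t) * z t = x t * z t - y t"
      by (simp add: Z_def power2_eq_square algebra_simps)
    finally show ?thesis by (simp add: mult.commute)
  qed
  have "inverse (- sqrt (1 - (p t)\<^sup>2)) * p'
      = (x' - (x t * y t - z t) / Y * y' - (x t * z t - y t) / Z * z') / ?A"
    unfolding chain[symmetric] root by simp
  with 1 show ?thesis unfolding Y_def Z_def by simp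
qed


section \<open>The Jacobian of the angles is negative definite\<close>

text \<open>The vertices of a triangle, as points \<open>p\<^sub>i\<close> of the hyperboloid, have Minkowski products
  \<open>- x\<close>, \<open>- y\<close>, \<open>- z\<close> (\<open>x\<close> for the edge opposite to vertex 1, and so on).  Numbers \<open>c\<^sub>i\<close> determine a
  vector whose products with the \<open>p\<^sub>i\<close> are \<open>- c\<^sub>i\<close>; for \<open>c\<^sub>i = cosh r\<^sub>i\<close> it points to the radical centre of
  the three vertex circles.  The weight of the edge \<open>12\<close> is, up to a positive factor, the coordinate
  of that vector along \<open>p\<^sub>3\<close> (see \<open>edge_weight_barycentric\<close>), hence negative when the radical centre
  lies beyond that edge.\<close>

definition edge_weight :: "real \<Rightarrow> real \<Rightarrow> real \<Rightarrow> real \<Rightarrow> real \<Rightarrow> real \<Rightarrow> real" where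
  "edge_weight x y z c\<^sub>1 c\<^sub>2 c\<^sub>3 =
     (c\<^sub>2 * (y * z - x) + c\<^sub>1 * (x * z - y)) / (z\<^sup>2 - 1) - c\<^sub>3"

definition edge_weights :: "real \<Rightarrow> real \<Rightarrow> real \<Rightarrow> real^3 \<Rightarrow> real^3" where
  "edge_weights x y z c = vector [edge_weight y z x (c$2) (c$3) (c$1),
     edge_weight z x y (c$3) (c$1) (c$2), edge_weight x y z (c$1) (c$2) (c$3)]"

text \<open>The linear map of the quadratic form
  \<open>n\<^sub>1 (2 v\<^sub>2 v\<^sub>3 - x (v\<^sub>2\<^sup>2 + v\<^sub>3\<^sup>2)) + n\<^sub>2 (2 v\<^sub>3 v\<^sub>1 - y (v\<^sub>3\<^sup>2 + v\<^sub>1\<^sup>2)) + n\<^sub>3 (2 v\<^sub>1 v\<^sub>2 - z (v\<^sub>1\<^sup>2 + v\<^sub>2\<^sup>2))\<close>,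
  a graph Laplacian of the triangle with edge weights \<open>n\<close> and a hyperbolic correction on the diagonal.
  Written in this way, the symmetry of the Jacobian of the angles is evident.\<close>

definition edge_form :: "real \<Rightarrow> real \<Rightarrow> real \<Rightarrow> real^3 \<Rightarrow> real^3 \<Rightarrow> real^3" where
  "edge_form x y z n v =
     vector [n$3 * (v$2 - z * v$1) + n$2 * (v$3 - y * v$1),
             n$1 * (v$3 - x * v$2) + n$3 * (v$1 - z * v$2),
             n$2 * (v$1 - y * v$3) + n$1 * (v$2 - x * v$3)]"

lemma inner_3: "(u::real^3) \<bullet> v = u$1 * v$1 + u$2 * v$2 + u$3 * v$3"
  by (simp add: inner_vec_def sum_3)

lemma vec_eq_3: "(u::real^3) = v \<longleftrightarrow> u$1 = v$1 \<and> u$2 = v$2 \<and> u$3 = v$3"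
  unfolding vec_eq_iff forall_3 ..

lemma edge_form_symmetric: "u \<bullet> edge_form x y z n v = edge_form x y z n u \<bullet> v"
  by (simp add: edge_form_def inner_3 algebra_simps)

lemma linear_edge_form: "linear (edge_form x y z n)"
  by (rule linearI) (simp_all add: edge_form_def vec_eq_3, simp_all add: algebra_simps)

lemma edge_form_add_weights:
  "edge_form x y z (n + k *\<^sub>R m) v = edge_form x y z n v + k *\<^sub>R edge_form x y z m v"
  by (simp add: edge_form_def vec_eq_3, simp add: algebra_simps)

lemma edge_weights_linear:
  "edge_weights x y z (c + k *\<^sub>R d) = edge_weights x y z c + k *\<^sub>R edge_weights x y z d"
proof -
  have "edge_weight x y z (p + k * p') (q + k * q') (r + k * r')
      = edge_weight x y z p q r + k * edge_weight x y z p' q' r'" for x y z p q r p' q' r'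
  proof -
    obtain R Q where e: "\<And>a b d. edge_weight x y z a b d = b * R + a * Q - d"
      unfolding edge_weight_def add_divide_distrib times_divide_eq_right[symmetric] by blast
    show ?thesis unfolding e by (simp add: algebra_simps)
  qed
  then show ?thesis by (simp add: edge_weights_def vec_eq_3)
qed

text \<open>The derivative of the hyperbolic cosine \<open>x\<close> of an edge length in the direction
  \<open>(v\<^sub>1, v\<^sub>2)\<close> of the variables \<open>- w\<^sub>i = ln (tanh (r\<^sub>i / 2))\<close> at its two ends, where \<open>c\<^sub>i = cosh r\<^sub>i\<close>.
  The inversive distance is eliminated in favour of \<open>x\<close>, which makes it linear in \<open>c\<close>.\<close>

definition d_edge :: "real \<Rightarrow> real \<Rightarrow> real \<Rightarrow> real \<Rightarrow> real \<Rightarrow> real" where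
  "d_edge x c\<^sub>1 c\<^sub>2 v\<^sub>1 v\<^sub>2 = (c\<^sub>1 * x - c\<^sub>2) * v\<^sub>1 + (c\<^sub>2 * x - c\<^sub>1) * v\<^sub>2"

text \<open>The right-hand side is what the law of cosines gives for the variation of an angle (see
  \<open>DERIV_tri_angle\<close>); collecting the coefficients of \<open>v\<^sub>1\<close>, \<open>v\<^sub>2\<close>, \<open>v\<^sub>3\<close> turns it into the Laplacian form.\<close>

lemma edge_weight_d_edge:
  assumes gt: "1 < y" "1 < z"
  shows "edge_weight x y z c\<^sub>1 c\<^sub>2 c\<^sub>3 * (v\<^sub>2 - z * v\<^sub>1) + edge_weight z x y c\<^sub>3 c\<^sub>1 c\<^sub>2 * (v\<^sub>3 - y * v\<^sub>1)
    = d_edge x c\<^sub>2 c\<^sub>3 v\<^sub>2 v\<^sub>3 - (x * y - z) / (y\<^sup>2 - 1) * d_edge y c\<^sub>3 c\<^sub>1 v\<^sub>3 v\<^sub>1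
      - (x * z - y) / (z\<^sup>2 - 1) * d_edge z c\<^sub>1 c\<^sub>2 v\<^sub>1 v\<^sub>2" (is "_ = ?D\<^sub>1 - _ * ?D\<^sub>2 - _ * ?D\<^sub>3")
proof -
  have YZ: "y\<^sup>2 - 1 \<noteq> 0" "z\<^sup>2 - 1 \<noteq> 0"
    using square_gt_1[OF gt(1)] square_gt_1[OF gt(2)] by auto
  \<comment> \<open>\<open>P\<close>, \<open>Q\<close>, \<open>R\<close>, \<open>T\<close> are the four quotients that occur; they satisfy linear relations with
    coefficients \<open>y\<close> and \<open>z\<close>.\<close>
  define P Q R T where "P = (x * y - z) / (y\<^sup>2 - 1)" and "Q = (x * z - y) / (z\<^sup>2 - 1)"
    and "R = (y * z - x) / (z\<^sup>2 - 1)" and "T = (y * z - x) / (y\<^sup>2 - 1)"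
  have R: "R = x - Q * z" and T: "T = x - P * y"
    using YZ by (simp_all add: P_def Q_def R_def T_def field_simps power2_eq_square)
  have P: "y * T = z - P" and Q: "z * R = y - Q"
    using YZ by (simp_all add: P_def Q_def R_def T_def field_simps power2_eq_square)
  have n3: "edge_weight x y z c\<^sub>1 c\<^sub>2 c\<^sub>3 = c\<^sub>2 * R + c\<^sub>1 * Q - c\<^sub>3"
    by (simp add: edge_weight_def R_def Q_def add_divide_distrib)
  have n2: "edge_weight z x y c\<^sub>3 c\<^sub>1 c\<^sub>2 = c\<^sub>1 * P + c\<^sub>3 * T - c\<^sub>2"
    by (simp add: edge_weight_def P_def T_def add_divide_distrib mult.commute)
  have "(c\<^sub>2 * R + c\<^sub>1 * Q - c\<^sub>3) * (v\<^sub>2 - z * v\<^sub>1) + (c\<^sub>1 * P + c\<^sub>3 * T - c\<^sub>2) * (v\<^sub>3 - y * v\<^sub>1)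
    = (c\<^sub>2 * R + c\<^sub>1 * Q - c\<^sub>3) * v\<^sub>2 + (c\<^sub>1 * P + c\<^sub>3 * T - c\<^sub>2) * v\<^sub>3
      - (c\<^sub>2 * (z * R) + c\<^sub>1 * Q * z - c\<^sub>3 * z + c\<^sub>1 * P * y + c\<^sub>3 * (y * T) - c\<^sub>2 * y) * v\<^sub>1"
    by (simp add: algebra_simps)
  also have "\<dots> = ?D\<^sub>1 - P * ?D\<^sub>2 - Q * ?D\<^sub>3"
    unfolding P Q unfolding R T d_edge_def by (simp add: algebra_simps)
  finally show ?thesis unfolding n3 n2 P_def Q_def .
qed

lemma edge_form_d_edge:
  fixes c v :: "real^3"
  assumes gt: "1 < x" "1 < y" "1 < z"
  defines "D\<^sub>1 \<equiv> d_edge x (c$2) (c$3) (v$2) (v$3)"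
    and "D\<^sub>2 \<equiv> d_edge y (c$3) (c$1) (v$3) (v$1)"
    and "D\<^sub>3 \<equiv> d_edge z (c$1) (c$2) (v$1) (v$2)"
  shows "edge_form x y z (edge_weights x y z c) v = vector
     [D\<^sub>1 - (x * y - z) / (y\<^sup>2 - 1) * D\<^sub>2 - (x * z - y) / (z\<^sup>2 - 1) * D\<^sub>3,
      D\<^sub>2 - (y * z - x) / (z\<^sup>2 - 1) * D\<^sub>3 - (y * x - z) / (x\<^sup>2 - 1) * D\<^sub>1,
      D\<^sub>3 - (z * x - y) / (x\<^sup>2 - 1) * D\<^sub>1 - (z * y - x) / (y\<^sup>2 - 1) * D\<^sub>2]"
  unfolding vec_eq_3 D\<^sub>1_def D\<^sub>2_def D\<^sub>3_def edge_form_def edge_weights_def vector_3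
  by (intro conjI edge_weight_d_edge gt)

text \<open>All coefficients of \<open>d_edge\<close> are positive: each edge becomes longer when the circle at either
  of its ends grows.\<close>

definition admissible :: "real \<Rightarrow> real \<Rightarrow> real \<Rightarrow> real^3 \<Rightarrow> bool" where
  "admissible x y z c \<longleftrightarrow>
     c$3 < c$2 * x \<and> c$2 < c$3 * x \<and> c$1 < c$3 * y \<and> c$3 < c$1 * y \<and> c$2 < c$1 * z \<and> c$1 < c$2 * z"

lemma admissible_cone:
  assumes "admissible x y z c" "admissible x y z d" "0 \<le> k"
  shows "admissible x y z (c + k *\<^sub>R d)"
proof -
  have "a + k * a' < (b + k * b') * u" if "a < b * u" "a' < b' * u" for a a' b b' u
    using that mult_left_mono[of a' "b' * u" k] assms(3) by (simp add: algebra_simps)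
  then show ?thesis using assms by (auto simp: admissible_def)
qed

text \<open>Each equation forces opposite signs on two of the three unknowns, and going around the
  triangle changes the sign an odd number of times.\<close>

lemma opposite_signs_zero:
  fixes v\<^sub>1 v\<^sub>2 v\<^sub>3 :: real
  assumes pos: "0 < a\<^sub>1" "0 < b\<^sub>1" "0 < a\<^sub>2" "0 < b\<^sub>2" "0 < a\<^sub>3" "0 < b\<^sub>3"
    and eq: "a\<^sub>1 * v\<^sub>2 + b\<^sub>1 * v\<^sub>3 = 0" "a\<^sub>2 * v\<^sub>3 + b\<^sub>2 * v\<^sub>1 = 0" "a\<^sub>3 * v\<^sub>1 + b\<^sub>3 * v\<^sub>2 = 0"
  shows "v\<^sub>1 = 0 \<and> v\<^sub>2 = 0 \<and> v\<^sub>3 = 0"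
proof -
  have sg: "sgn q = - sgn p" if "0 < a" "0 < b" "a * p + b * q = 0" for a b p q :: real
  proof -
    have "b * q = a * (- p)" using that by simp
    then have "sgn (b * q) = sgn (a * (- p))" by simp
    then show ?thesis using that by (simp add: sgn_mult)
  qed
  have "sgn v\<^sub>3 = - sgn v\<^sub>2" "sgn v\<^sub>1 = - sgn v\<^sub>3" "sgn v\<^sub>2 = - sgn v\<^sub>1"
    using sg[OF pos(1,2) eq(1)] sg[OF pos(3,4) eq(2)] sg[OF pos(5,6) eq(3)] .
  then have "sgn v\<^sub>1 = 0" "sgn v\<^sub>2 = 0" "sgn v\<^sub>3 = 0" by auto
  then show ?thesis by (simp add: sgn_0_0)
qed

text \<open>A null vector leaves all angles fixed to first order.  The angles of a hyperbolic triangle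
  determine its edges, also infinitesimally, so the edges are fixed as well; since each edge is
  increasing in the two circles at its ends, nothing moves.  The step from angles to edges
  is a linear system with coefficients \<open>- adj G\<close>, for \<open>G\<close> the symmetric matrix with unit diagonal and
  off-diagonal entries \<open>x\<close>, \<open>y\<close>, \<open>z\<close>; multiplication by \<open>G\<close> diagonalizes it.\<close>

lemma edge_form_inj:
  assumes gt: "1 < x" "1 < y" "1 < z" and gram: "0 < gram x y z" and adm: "admissible x y z c"
    and zero: "edge_form x y z (edge_weights x y z c) v = 0"
  shows "v = 0"
proof -
  define X Y Z where "X = x\<^sup>2 - 1" and "Y = y\<^sup>2 - 1" and "Z = z\<^sup>2 - 1"
  have XYZ: "0 < X" "0 < Y" "0 < Z" using gt by (auto simp: X_def Y_def Z_def intro: square_gt_1)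
  define p q s where "p = d_edge x (c$2) (c$3) (v$2) (v$3) / X"
    and "q = d_edge y (c$3) (c$1) (v$3) (v$1) / Y" and "s = d_edge z (c$1) (c$2) (v$1) (v$2) / Z"
  have d: "d_edge x (c$2) (c$3) (v$2) (v$3) = X * p" "d_edge y (c$3) (c$1) (v$3) (v$1) = Y * q"
     "d_edge z (c$1) (c$2) (v$1) (v$2) = Z * s"
    using XYZ by (simp_all add: p_def q_def s_def)
  have "X * p - (x * y - z) / Y * (Y * q) - (x * z - y) / Z * (Z * s) = 0"
       "Y * q - (y * z - x) / Z * (Z * s) - (y * x - z) / X * (X * p) = 0"
       "Z * s - (z * x - y) / X * (X * p) - (z * y - x) / Y * (Y * q) = 0"
    using zero unfolding edge_form_d_edge[OF gt] vec_eq_3 d X_def[symmetric] Y_def[symmetric] Z_def[symmetric]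
    by simp_all
  then have e: "X * p - (x * y - z) * q - (x * z - y) * s = 0"
       "Y * q - (y * z - x) * s - (y * x - z) * p = 0"
       "Z * s - (z * x - y) * p - (z * y - x) * q = 0"
    using XYZ by simp_all
  \<comment> \<open>Minus the first row of \<open>G\<close> times the system; its second row serves for \<open>q\<close> below.\<close>
  have "gram x y z * p = - (X * p - (x * y - z) * q - (x * z - y) * s)
      - z * (Y * q - (y * z - x) * s - (y * x - z) * p) - y * (Z * s - (z * x - y) * p - (z * y - x) * q)"
    by (simp add: gram_def X_def Y_def Z_def power2_eq_square algebra_simps)
  then have p0: "p = 0" using gram unfolding e by simp
  have "gram x y z * q = - z * (X * p - (x * y - z) * q - (x * z - y) * s)
      - (Y * q - (y * z - x) * s - (y * x - z) * p) - x * (Z * s - (z * x - y) * p - (z * y - x) * q)"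
    by (simp add: gram_def X_def Y_def Z_def power2_eq_square algebra_simps)
  then have q0: "q = 0" using gram unfolding e by simp
  have s0: "s = 0" using e(3) XYZ unfolding p0 q0 by simp
  have "v$1 = 0 \<and> v$2 = 0 \<and> v$3 = 0"
    by (rule opposite_signs_zero[of "c$2 * x - c$3" "c$3 * x - c$2" "c$3 * y - c$1" "c$1 * y - c$3"
          "c$1 * z - c$2" "c$2 * z - c$1"])
      (use adm d in \<open>simp_all add: admissible_def d_edge_def p0 q0 s0\<close>)
  then show ?thesis by (simp add: vec_eq_3)
qed

text \<open>Completing the square on each edge, \<open>2 a b - x (a\<^sup>2 + b\<^sup>2) = - (a - b)\<^sup>2 - (x - 1) (a\<^sup>2 + b\<^sup>2)\<close>.\<close>

lemma edge_form_negative_if_pos_weights: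
  assumes gt: "1 < x" "1 < y" "1 < z" and pos: "0 < n$1" "0 < n$2" "0 < n$3" and "v \<noteq> 0"
  shows "v \<bullet> edge_form x y z n v < 0"
proof -
  have eq: "v \<bullet> edge_form x y z n v =
     - (n$1 * ((v$2 - v$3)\<^sup>2 + (x - 1) * ((v$2)\<^sup>2 + (v$3)\<^sup>2))
       + n$2 * ((v$3 - v$1)\<^sup>2 + (y - 1) * ((v$3)\<^sup>2 + (v$1)\<^sup>2))
       + n$3 * ((v$1 - v$2)\<^sup>2 + (z - 1) * ((v$1)\<^sup>2 + (v$2)\<^sup>2)))"
    by (simp add: edge_form_def inner_3 power2_eq_square algebra_simps)
  have nn: "0 \<le> m * ((a - b)\<^sup>2 + (u - 1) * (a\<^sup>2 + b\<^sup>2))" if "0 < m" "1 < u" for m u a b :: real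
    using that by simp
  have ps: "0 < m * ((a - b)\<^sup>2 + (u - 1) * (a\<^sup>2 + b\<^sup>2))" if "0 < m" "1 < u" "a \<noteq> 0 \<or> b \<noteq> 0" for m u a b :: real
  proof -
    have "0 < (u - 1) * (a\<^sup>2 + b\<^sup>2)" using that by (simp add: sum_power2_gt_zero_iff)
    then have "0 < (a - b)\<^sup>2 + (u - 1) * (a\<^sup>2 + b\<^sup>2)" by (intro add_nonneg_pos) auto
    then show ?thesis using that by simp
  qed
  have "v$1 \<noteq> 0 \<or> v$2 \<noteq> 0 \<or> v$3 \<noteq> 0" using \<open>v \<noteq> 0\<close> by (simp add: vec_eq_3)
  then show ?thesis unfolding eq neg_less_0_iff_less
    using nn[OF pos(1) gt(1), of "v$2" "v$3"] nn[OF pos(2) gt(2), of "v$3" "v$1"] nn[OF pos(3) gt(3), of "v$1" "v$2"]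
      ps[OF pos(1) gt(1), of "v$2" "v$3"] ps[OF pos(2) gt(2), of "v$3" "v$1"] ps[OF pos(3) gt(3), of "v$1" "v$2"]
    by linarith
qed

lemma edge_weight_barycentric:
  assumes "1 < z" and "c\<^sub>1 = p + z * q + y * s" "c\<^sub>2 = z * p + q + x * s" "c\<^sub>3 = y * p + x * q + s"
  shows "edge_weight x y z c\<^sub>1 c\<^sub>2 c\<^sub>3 = gram x y z * s / (z\<^sup>2 - 1)"
proof -
  have "edge_weight x y z c\<^sub>1 c\<^sub>2 c\<^sub>3 =
     (c\<^sub>2 * (y * z - x) + c\<^sub>1 * (x * z - y) - c\<^sub>3 * (z\<^sup>2 - 1)) / (z\<^sup>2 - 1)"
    using square_gt_1[OF assms(1)] by (simp add: edge_weight_def diff_divide_distrib)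
  also have "c\<^sub>2 * (y * z - x) + c\<^sub>1 * (x * z - y) - c\<^sub>3 * (z\<^sup>2 - 1) = gram x y z * s"
    unfolding assms(2-4) gram_def by (simp add: power2_eq_square algebra_simps)
  finally show ?thesis .
qed

text \<open>The incentre has barycentric coordinates proportional to \<open>sinh\<close> of the opposite edges.  They
  are positive, hence so are the weights.  Admissibility expresses that the lines from the incentre
  to the vertices make acute angles with the edges.\<close>

lemma incentre_weights:
  assumes gt: "1 < x" "1 < y" "1 < z" and gram: "0 < gram x y z"
  obtains c where "admissible x y z c" and "0 < edge_weights x y z c $ 1"
    "0 < edge_weights x y z c $ 2" "0 < edge_weights x y z c $ 3"
proof -
  define m where "m = (\<lambda>t::real. sqrt (t\<^sup>2 - 1))"
  have m: "0 < m t" "m t * m t = t\<^sup>2 - 1" if "1 < t" for t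
    using square_gt_1[OF that] by (auto simp: m_def)
  have key: "0 < (b * a - w) * m a + (a\<^sup>2 - 1) * m b"
    if "1 < a" "1 < b" "gram w a b = gram x y z" for a b w
  proof -
    have "(m a * m b)\<^sup>2 = (m a * m a) * (m b * m b)"
      by (simp add: power2_eq_square)
    then have "(b * a - w)\<^sup>2 < (m a * m b)\<^sup>2"
      using gram gram_eq[of w a b] unfolding m(2)[OF that(1)] m(2)[OF that(2)] that(3)
      by (simp add: mult.commute[of b a])
    then have "\<bar>b * a - w\<bar>\<^sup>2 < (m a * m b)\<^sup>2" by (simp only: power2_abs)
    moreover have "0 < m a * m b" using m(1) that(1,2) by simp
    ultimately have "\<bar>b * a - w\<bar> < m a * m b"
      by (intro power2_less_imp_less[of "\<bar>b * a - w\<bar>"]) linarith+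
    then have "0 < m a * (b * a - w + m a * m b)" using m[OF that(1)] by simp
    then show ?thesis unfolding m(2)[OF that(1), symmetric] by (simp add: algebra_simps)
  qed
  define c :: "real^3" where
    "c = vector [m x + z * m y + y * m z, z * m x + m y + x * m z, y * m x + x * m y + m z]"
  show thesis
  proof
    show "admissible x y z c"
      using key[of x z y] key[of x y z] key[of y x z] key[of y z x] key[of z x y] key[of z y x] gt
      by (simp add: admissible_def c_def gram_def power2_eq_square algebra_simps)
    have "edge_weight y z x (c$2) (c$3) (c$1) = gram y z x * m x / (x\<^sup>2 - 1)"
      by (rule edge_weight_barycentric[where p = "m y" and q = "m z", OF gt(1)]) (simp_all add: c_def)
    then show "0 < edge_weights x y z c $ 1"
      using gram m[OF gt(1)] square_gt_1[OF gt(1)] by (simp add: edge_weights_def gram_rotate(1)[of y z x])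
    have "edge_weight z x y (c$3) (c$1) (c$2) = gram z x y * m y / (y\<^sup>2 - 1)"
      by (rule edge_weight_barycentric[where p = "m z" and q = "m x", OF gt(2)]) (simp_all add: c_def)
    then show "0 < edge_weights x y z c $ 2"
      using gram m[OF gt(2)] square_gt_1[OF gt(2)] by (simp add: edge_weights_def gram_rotate(2)[of z x y])
    have "edge_weight x y z (c$1) (c$2) (c$3) = gram x y z * m z / (z\<^sup>2 - 1)"
      by (rule edge_weight_barycentric[where p = "m x" and q = "m y", OF gt(3)]) (simp_all add: c_def)
    then show "0 < edge_weights x y z c $ 3"
      using gram m[OF gt(3)] square_gt_1[OF gt(3)] by (simp add: edge_weights_def)
  qed
qed

text \<open>The weights need not be positive, so the sign is not visible from the form itself.  For a
  fixed triangle, however, the form is linear in \<open>c\<close>, it is nonsingular on the convex cone of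
  admissible \<open>c\<close>, and it is negative definite at the incentre.\<close>

theorem edge_form_negative_definite:
  assumes gt: "1 < x" "1 < y" "1 < z" and gram: "0 < gram x y z" and adm: "admissible x y z c"
    and "v \<noteq> 0"
  shows "v \<bullet> edge_form x y z (edge_weights x y z c) v < 0"
proof -
  obtain d where d: "admissible x y z d" "0 < edge_weights x y z d $ 1"
    "0 < edge_weights x y z d $ 2" "0 < edge_weights x y z d $ 3"
    using incentre_weights[OF gt gram] .
  let ?f = "edge_form x y z (edge_weights x y z c)" and ?g = "edge_form x y z (edge_weights x y z d)"
  show ?thesis
  proof (rule negative_definite_pencil[of ?f ?g, OF linear_edge_form edge_form_symmetric
        linear_edge_form edge_form_symmetric _ _ \<open>v \<noteq> 0\<close>])
    show "u \<bullet> ?g u < 0" if "u \<noteq> 0" for u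
      using edge_form_negative_if_pos_weights[OF gt d(2-4) that] .
    show "u = 0" if "0 \<le> k" and zero: "?f u + k *\<^sub>R ?g u = 0" for k u
      using edge_form_inj[OF gt gram admissible_cone[OF adm d(1) \<open>0 \<le> k\<close>], of u] zero
      by (simp add: edge_weights_linear edge_form_add_weights)
  qed
qed

section \<open>Monotonicity of the generalized angles on one face\<close>

definition coth :: "real \<Rightarrow> real" where
  "coth u = cosh u / sinh u"

text \<open>In the variables \<open>w\<^sub>i = arsinh (1 / sinh r\<^sub>i)\<close> one has \<open>cosh r\<^sub>i = coth w\<^sub>i\<close> and
  \<open>sinh r\<^sub>i = 1 / sinh w\<^sub>i\<close>, so \<open>edge_cosh J w\<^sub>i w\<^sub>j\<close> is the hyperbolic cosine of the length of an edge
  with inversive distance \<open>J\<close>.\<close>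

definition edge_cosh :: "real \<Rightarrow> real \<Rightarrow> real \<Rightarrow> real" where
  "edge_cosh J p q = (cosh p * cosh q + J) / (sinh p * sinh q)"

lemma edge_cosh_commute: "edge_cosh J p q = edge_cosh J q p"
  by (simp add: edge_cosh_def mult.commute)

lemma edge_cosh_gt_1:
  assumes "0 \<le> J" "0 < p" "0 < q"
  shows "1 < edge_cosh J p q"
proof -
  have "sinh p * sinh q < cosh p * cosh q"
    using assms sinh_less_cosh_real[of p] sinh_less_cosh_real[of q] by (intro mult_strict_mono) auto
  then show ?thesis using assms by (simp add: edge_cosh_def)
qed

text \<open>The identity \<open>cosh\<^sup>2 - sinh\<^sup>2 = 1\<close> makes the coefficients of \<open>d_edge\<close> manifestly positive for
  \<open>J \<ge> 0\<close>.\<close>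

lemma coth_edge_cosh:
  assumes "0 < p" "0 < q"
  shows "coth p * edge_cosh J p q - coth q = (cosh q + J * cosh p) / ((sinh p)\<^sup>2 * sinh q)"
proof -
  have nz: "sinh p \<noteq> 0" "sinh q \<noteq> 0" using assms by auto
  have "coth p * edge_cosh J p q - coth q
     = ((cosh p * cosh p - sinh p * sinh p) * cosh q + J * cosh p) / ((sinh p)\<^sup>2 * sinh q)"
    unfolding coth_def edge_cosh_def using nz by (simp add: divide_simps power2_eq_square) (simp add: algebra_simps)
  also have "cosh p * cosh p - sinh p * sinh p = 1"
    using cosh_square_eq[of p] by (simp add: power2_eq_square)
  finally show ?thesis by simp
qed

lemma coth_less_edge_cosh:
  assumes "0 \<le> J" "0 < p" "0 < q"
  shows "coth q < coth p * edge_cosh J p q"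
proof -
  have "0 < (cosh q + J * cosh p) / ((sinh p)\<^sup>2 * sinh q)"
    using assms cosh_real_pos[of p] cosh_real_pos[of q] by (intro divide_pos_pos add_pos_nonneg) auto
  then show ?thesis using coth_edge_cosh[OF assms(2,3), of J] by linarith
qed

lemma DERIV_edge_cosh:
  assumes p: "(p has_real_derivative p') (at t)" and q: "(q has_real_derivative q') (at t)"
    and pos: "0 < p t" "0 < q t"
  shows "((\<lambda>s. edge_cosh J (p s) (q s)) has_real_derivative
    - d_edge (edge_cosh J (p t) (q t)) (coth (p t)) (coth (q t)) p' q') (at t)"
proof -
  have nz: "sinh (p t) \<noteq> 0" "sinh (q t) \<noteq> 0" using pos by auto
  let ?E' = "((sinh (p t) * p' * cosh (q t) + sinh (q t) * q' * cosh (p t)) * (sinh (p t) * sinh (q t))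
      - (cosh (p t) * cosh (q t) + J) * (cosh (p t) * p' * sinh (q t) + cosh (q t) * q' * sinh (p t)))
      / ((sinh (p t) * sinh (q t)) * (sinh (p t) * sinh (q t)))"
  have "((\<lambda>s. edge_cosh J (p s) (q s)) has_real_derivative ?E') (at t)"
    unfolding edge_cosh_def
    by (rule derivative_eq_intros p q refl | use nz in \<open>simp; fail\<close>)+
  moreover have "?E' = - d_edge (edge_cosh J (p t) (q t)) (coth (p t)) (coth (q t)) p' q'"
    unfolding d_edge_def coth_def edge_cosh_def using nz by (simp add: divide_simps) (simp add: algebra_simps)
  ultimately show ?thesis by simp
qed

text \<open>Entry \<open>i\<close> of \<open>J\<close> is the inversive distance of the edge opposite to vertex \<open>i\<close>.\<close>

definition face_cosh :: "real^3 \<Rightarrow> real^3 \<Rightarrow> real^3" where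
  "face_cosh J w = vector [edge_cosh (J$1) (w$2) (w$3), edge_cosh (J$2) (w$3) (w$1), edge_cosh (J$3) (w$1) (w$2)]"

definition face_angles :: "real^3 \<Rightarrow> real^3 \<Rightarrow> real^3" where
  "face_angles J w = (let x = face_cosh J w in
     vector [tri_angle (x$1) (x$2) (x$3), tri_angle (x$2) (x$3) (x$1), tri_angle (x$3) (x$1) (x$2)])"

definition face_gram :: "real^3 \<Rightarrow> real^3 \<Rightarrow> real" where
  "face_gram J w = gram (face_cosh J w $ 1) (face_cosh J w $ 2) (face_cosh J w $ 3)"

lemma face_cosh_gt_1:
  assumes "\<And>i. 0 \<le> J $ i" "\<And>i. 0 < w $ i"
  shows "1 < face_cosh J w $ 1" "1 < face_cosh J w $ 2" "1 < face_cosh J w $ 3"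
  using assms by (simp_all add: face_cosh_def edge_cosh_gt_1)

lemma face_angles_degenerate:
  assumes "\<And>i. 0 \<le> J $ i" "\<And>i. 0 < w $ i" and "face_gram J w \<le> 0"
  shows "face_angles J w $ i \<in> {0, pi}"
proof -
  note gt = face_cosh_gt_1[of J w, OF assms(1,2)]
  let ?x = "face_cosh J w $ 1" and ?y = "face_cosh J w $ 2" and ?z = "face_cosh J w $ 3"
  have "gram ?x ?y ?z \<le> 0" "gram ?y ?z ?x \<le> 0" "gram ?z ?x ?y \<le> 0"
    using assms(3) gram_rotate(1)[of ?y ?z ?x] gram_rotate(2)[of ?z ?x ?y]
    unfolding face_gram_def by linarith+
  then have "\<forall>i. face_angles J w $ i \<in> {0, pi}"
    unfolding forall_3 face_angles_def Let_def vector_3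
    using gt by (intro conjI tri_angle_degenerate)
  then show ?thesis by blast
qed

text \<open>Minus the derivative of the pairing is, up to a positive factor, the form \<open>edge_form\<close> at \<open>v\<close>.\<close>

lemma DERIV_face_angles:
  fixes a v :: "real^3"
  assumes J: "\<And>i. 0 \<le> J $ i" and pos: "\<And>i. 0 < (a + t *\<^sub>R v) $ i"
    and gram: "0 < face_gram J (a + t *\<^sub>R v)" and "v \<noteq> 0"
  shows "\<exists>D>0. ((\<lambda>s. v \<bullet> face_angles J (a + s *\<^sub>R v)) has_real_derivative D) (at t)"
proof -
  define w where "w = (\<lambda>s. a + s *\<^sub>R v)"
  define x y z where "x = (\<lambda>s. face_cosh J (w s) $ 1)" and "y = (\<lambda>s. face_cosh J (w s) $ 2)"
    and "z = (\<lambda>s. face_cosh J (w s) $ 3)"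
  have w: "((\<lambda>s. w s $ i) has_real_derivative v $ i) (at t)" for i
    unfolding w_def by (auto intro!: derivative_eq_intros)
  have wpos: "0 < w t $ i" for i using pos by (simp add: w_def)
  have gt: "1 < x t" "1 < y t" "1 < z t"
    using face_cosh_gt_1[of J "w t", OF J wpos] by (simp_all add: x_def y_def z_def)
  have g1: "0 < gram (x t) (y t) (z t)"
    using gram by (simp add: face_gram_def x_def y_def z_def w_def)
  have g2: "gram (y t) (z t) (x t) = gram (x t) (y t) (z t)"
    and g3: "gram (z t) (x t) (y t) = gram (x t) (y t) (z t)"
    by (rule gram_rotate)+
  define c :: "real^3" where "c = (\<chi> i. coth (w t $ i))"
  let ?D1 = "d_edge (x t) (c$2) (c$3) (v$2) (v$3)"
  let ?D2 = "d_edge (y t) (c$3) (c$1) (v$3) (v$1)"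
  let ?D3 = "d_edge (z t) (c$1) (c$2) (v$1) (v$2)"
  have dx: "(x has_real_derivative - ?D1) (at t)"
    and dy: "(y has_real_derivative - ?D2) (at t)"
    and dz: "(z has_real_derivative - ?D3) (at t)"
    using DERIV_edge_cosh[OF w[of 2] w[of 3] wpos wpos, of "J$1"]
      DERIV_edge_cosh[OF w[of 3] w[of 1] wpos wpos, of "J$2"]
      DERIV_edge_cosh[OF w[of 1] w[of 2] wpos wpos, of "J$3"]
    unfolding x_def y_def z_def face_cosh_def vector_3 c_def vec_lambda_beta .
  let ?A = "sqrt (gram (x t) (y t) (z t))"
  let ?q = "v \<bullet> edge_form (x t) (y t) (z t) (edge_weights (x t) (y t) (z t) c) v"
  note d1 = DERIV_tri_angle[OF dx dy dz gt(2,3) g1]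
  note d2 = DERIV_tri_angle[OF dy dz dx gt(3,1), unfolded g2, OF g1]
  note d3 = DERIV_tri_angle[OF dz dx dy gt(1,2), unfolded g3, OF g1]
  note d = DERIV_add[OF DERIV_add[OF DERIV_cmult[OF d1, of "v$1"] DERIV_cmult[OF d2, of "v$2"]]
      DERIV_cmult[OF d3, of "v$3"]]
  have along: "(\<lambda>s. v \<bullet> face_angles J (a + s *\<^sub>R v)) = (\<lambda>s. v$1 * tri_angle (x s) (y s) (z s)
      + v$2 * tri_angle (y s) (z s) (x s) + v$3 * tri_angle (z s) (x s) (y s))"
    by (simp add: face_angles_def inner_3 Let_def x_def y_def z_def w_def)
  have sum: "v1 * ((- D1 - m * - D2 - n * - D3) / A) + v2 * ((- D2 - m' * - D3 - n' * - D1) / A)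
      + v3 * ((- D3 - m'' * - D1 - n'' * - D2) / A)
    = - (v1 * (D1 - m * D2 - n * D3) + v2 * (D2 - m' * D3 - n' * D1) + v3 * (D3 - m'' * D1 - n'' * D2)) / A"
    for v1 v2 v3 D1 D2 D3 m n m' n' m'' n'' A :: real
    by (simp add: add_divide_distrib diff_divide_distrib right_diff_distrib distrib_left)
  have "((\<lambda>s. v \<bullet> face_angles J (a + s *\<^sub>R v)) has_real_derivative - ?q / ?A) (at t)"
    unfolding along edge_form_d_edge[OF gt] inner_3[of v "vector _"] vector_3 by (rule d[unfolded sum])
  moreover have "?q < 0"
  proof (rule edge_form_negative_definite[OF gt g1 _ \<open>v \<noteq> 0\<close>])
    have less: "coth (w t $ k) < coth (w t $ i) * edge_cosh (J $ j) (w t $ i) (w t $ k)"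
      and less': "coth (w t $ k) < coth (w t $ i) * edge_cosh (J $ j) (w t $ k) (w t $ i)" for i j k
      using coth_less_edge_cosh[OF J wpos wpos, of k i j]
      by (simp_all only: edge_cosh_commute[of _ "w t $ k"])
    show "admissible (x t) (y t) (z t) c"
      unfolding admissible_def c_def x_def y_def z_def face_cosh_def vector_3 vec_lambda_beta
      by (intro conjI less less')
  qed
  then have "0 < - ?q / ?A" using g1 by (intro divide_pos_pos) auto
  ultimately show ?thesis by blast
qed

lemma continuous_on_face_angles:
  assumes J: "\<And>i. 0 \<le> J $ i" and w: "continuous_on S w" and pos: "\<And>t i. t \<in> S \<Longrightarrow> 0 < w t $ i"
  shows "continuous_on S (\<lambda>t. u \<bullet> face_angles J (w t))"
proof -
  have c: "continuous_on S (\<lambda>t. edge_cosh j (w t $ i) (w t $ k))" for j i k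
    unfolding edge_cosh_def using pos
    by (intro continuous_intros w) (auto simp: less_imp_neq[symmetric] dest: pos[of _ i] pos[of _ k])
  have "continuous_on S (\<lambda>t. face_cosh J (w t) $ 1)" "continuous_on S (\<lambda>t. face_cosh J (w t) $ 2)"
    "continuous_on S (\<lambda>t. face_cosh J (w t) $ 3)"
    using c by (simp_all add: face_cosh_def)
  note t = continuous_on_tri_angle[OF this(1,2,3)] continuous_on_tri_angle[OF this(2,3,1)]
    continuous_on_tri_angle[OF this(3,1,2)]
  show ?thesis unfolding face_angles_def inner_3 Let_def vector_3
    by (intro continuous_intros t face_cosh_gt_1 J pos)
qed

text \<open>Along the segment from \<open>a\<close> to \<open>b\<close> the pairing of the angles with \<open>b - a\<close> increases as long as
  the triangle is nondegenerate.  On degenerate triangles all angles are \<open>0\<close> or \<open>\<pi>\<close>, so there the pairing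
  has at most eight values, and it cannot jump back because it is continuous.  This
  covers segments that enter and leave the degenerate region repeatedly.\<close>

theorem face_angles_monotone:
  fixes a b J :: "real^3"
  assumes J: "\<And>i. 0 \<le> J $ i" and a: "\<And>i. 0 < a $ i" and b: "\<And>i. 0 < b $ i"
  shows "0 \<le> (b - a) \<bullet> (face_angles J b - face_angles J a)" (is ?weak)
    and "0 < face_gram J a \<Longrightarrow> a \<noteq> b \<Longrightarrow> 0 < (b - a) \<bullet> (face_angles J b - face_angles J a)"
      (is "_ \<Longrightarrow> _ \<Longrightarrow> ?strict")
proof -
  define v where "v = b - a"
  define g where "g = (\<lambda>t. v \<bullet> face_angles J (a + t *\<^sub>R v))"
  have g01: "g 0 = v \<bullet> face_angles J a" "g 1 = v \<bullet> face_angles J b"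
    by (simp_all add: g_def v_def)
  \<comment> \<open>The segment stays in the convex domain.\<close>
  have pos: "0 < (a + t *\<^sub>R v) $ i" if "t \<in> {0..1}" for t i
  proof -
    have "(a + t *\<^sub>R v) $ i = (1 - t) * a $ i + t * b $ i" by (simp add: v_def algebra_simps)
    moreover have "0 < (1 - t) * a $ i + t * b $ i"
      using that a[of i] b[of i] by (cases "t = 0") (auto intro: add_nonneg_pos)
    ultimately show ?thesis by simp
  qed
  have mono: "g s \<le> g 1" if "0 \<le> s" "s \<le> 1" "v \<noteq> 0" for s
  proof (rule mono_if_pos_deriv_off_finite[OF \<open>s \<le> 1\<close>])
    show "continuous_on {s..1} g" unfolding g_def
      by (rule continuous_on_face_angles) (use J pos that in \<open>auto intro!: continuous_intros\<close>)
    \<comment> \<open>The values of the pairing when every angle is \<open>0\<close> or \<open>\<pi>\<close>.\<close>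
    let ?V = "(\<lambda>(p, q, r). v$1 * p + v$2 * q + v$3 * r) ` ({0, pi} \<times> {0, pi} \<times> {0, pi})"
    show "finite ?V" by simp
    show "g t \<in> ?V \<or> (\<exists>D>0. DERIV g t :> D)" if "t \<in> {s..1}" for t
    proof (cases "0 < face_gram J (a + t *\<^sub>R v)")
      case True
      then show ?thesis unfolding g_def
        using DERIV_face_angles[OF J pos True \<open>v \<noteq> 0\<close>] that \<open>0 \<le> s\<close> by auto
    next
      case False
      have "face_angles J (a + t *\<^sub>R v) $ i \<in> {0, pi}" for i
        by (rule face_angles_degenerate[OF J pos]) (use False that \<open>0 \<le> s\<close> in auto)
      then have "(face_angles J (a + t *\<^sub>R v) $ 1, face_angles J (a + t *\<^sub>R v) $ 2,
          face_angles J (a + t *\<^sub>R v) $ 3) \<in> {0, pi} \<times> {0, pi} \<times> {0, pi}" by blast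
      then have "g t \<in> ?V" unfolding g_def inner_3 by (rule rev_image_eqI) simp
      then show ?thesis ..
    qed
  qed
  show ?weak using mono[of 0] g01 unfolding v_def[symmetric] inner_diff_right
    by (cases "v = 0") auto
  show ?strict if gram: "0 < face_gram J a" and "a \<noteq> b"
  proof -
    have v: "v \<noteq> 0" using \<open>a \<noteq> b\<close> by (simp add: v_def)
    have "\<exists>D>0. DERIV g 0 :> D"
      unfolding g_def by (rule DERIV_face_angles) (use J a gram v in auto)
    then obtain D where "D > 0" "DERIV g 0 :> D" by blast
    from DERIV_pos_inc_right[OF this(2,1)]
    obtain d where d: "d > 0" "\<And>h. 0 < h \<Longrightarrow> h < d \<Longrightarrow> g 0 < g h" by auto
    define h where "h = min (d/2) 1"
    have "g 0 < g h" using d by (auto simp: h_def)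
    also have "g h \<le> g 1" by (rule mono) (use d v in \<open>auto simp: h_def\<close>)
    finally show ?thesis using g01 unfolding v_def[symmetric] inner_diff_right by simp
  qed
qed

section \<open>From faces to the triangulation\<close>

text \<open>Equal to \<open>- ln (tanh (r\<^sub>i / 2))\<close>.  These are the variables in which the Jacobian of the angles is
  symmetric, and all of \<open>pos_radii\<close> is mapped into the convex set of positive vectors.  The form
  with \<open>arsinh\<close> shows the duality \<open>sinh w\<^sub>i * sinh r\<^sub>i = 1\<close>.\<close>

definition dual_radius :: "real^'n \<Rightarrow> 'n \<Rightarrow> real" where
  "dual_radius r i = arsinh (1 / sinh (r $ i))"

lemma dual_radius_pos: "r \<in> pos_radii \<Longrightarrow> 0 < dual_radius r i"
  by (simp add: dual_radius_def pos_radii_def)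

lemma sinh_cosh_dual_radius:
  assumes "r \<in> pos_radii"
  shows "sinh (dual_radius r i) = 1 / sinh (r $ i)"
    and "cosh (dual_radius r i) = cosh (r $ i) / sinh (r $ i)"
proof -
  have s: "0 < sinh (r $ i)" using assms by (simp add: pos_radii_def)
  show "sinh (dual_radius r i) = 1 / sinh (r $ i)" by (simp add: dual_radius_def)
  have "(cosh (r $ i) / sinh (r $ i))\<^sup>2 = (1 / sinh (r $ i))\<^sup>2 + 1"
    using s by (simp add: power_divide cosh_square_eq field_simps)
  then show "cosh (dual_radius r i) = cosh (r $ i) / sinh (r $ i)"
    using s cosh_real_pos[of "r $ i"] unfolding dual_radius_def cosh_arsinh_real
    by (intro real_sqrt_unique) auto
qed

lemma dual_radius_inj:
  assumes "r \<in> pos_radii" "s \<in> pos_radii" "dual_radius r i = dual_radius s i"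
  shows "r $ i = s $ i"
proof -
  have "1 / sinh (r $ i) = 1 / sinh (s $ i)"
    using sinh_cosh_dual_radius(1)[OF assms(1)] sinh_cosh_dual_radius(1)[OF assms(2)] assms(3) by metis
  then show ?thesis by (simp add: inverse_eq_divide[symmetric])
qed

lemma cosh_edge_length:
  assumes "r \<in> pos_radii" "0 \<le> I {i, j}"
  shows "cosh (edge_length I r i j) = edge_cosh (I {i, j}) (dual_radius r i) (dual_radius r j)"
    and "0 < edge_length I r i j"
proof -
  have "0 < sinh (r $ i)" "0 < sinh (r $ j)" using assms(1) by (simp_all add: pos_radii_def)
  then have "edge_cosh (I {i, j}) (dual_radius r i) (dual_radius r j)
      = cosh (r $ i) * cosh (r $ j) + I {i, j} * sinh (r $ i) * sinh (r $ j)"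
    by (simp add: edge_cosh_def sinh_cosh_dual_radius[OF assms(1)] field_simps)
  moreover have "1 < edge_cosh (I {i, j}) (dual_radius r i) (dual_radius r j)"
    by (intro edge_cosh_gt_1 assms dual_radius_pos)
  ultimately show "cosh (edge_length I r i j) = edge_cosh (I {i, j}) (dual_radius r i) (dual_radius r j)"
    and "0 < edge_length I r i j"
    using arcosh_real_strict_mono[of 1 "edge_cosh (I {i, j}) (dual_radius r i) (dual_radius r j)"]
    by (simp_all add: edge_length_def cosh_arcosh_real)
qed

lemma tri_angle_cosh:
  assumes pos: "0 < a" "0 < b" "0 < c"
  defines "p \<equiv> (cosh b * cosh c - cosh a) / (sinh b * sinh c)"
  shows "tri_angle (cosh a) (cosh b) (cosh c) =
      (if b + c \<le> a then pi else if a \<le> \<bar>b - c\<bar> then 0 else arccos p)"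
    and "0 < gram (cosh a) (cosh b) (cosh c) \<longleftrightarrow> a < b + c \<and> \<bar>b - c\<bar> < a"
proof -
  have s: "0 < sinh b * sinh c" using pos by simp
  have root: "sqrt (((cosh b)\<^sup>2 - 1) * ((cosh c)\<^sup>2 - 1)) = sinh b * sinh c"
    using pos by (simp add: cosh_square_eq real_sqrt_mult)
  have p: "(cosh b * cosh c - cosh a) / sqrt (((cosh b)\<^sup>2 - 1) * ((cosh c)\<^sup>2 - 1)) = p"
    unfolding root p_def ..
  have "p \<le> - 1 \<longleftrightarrow> cosh (b + c) \<le> cosh a"
    unfolding p_def pos_divide_le_eq[OF s] cosh_add by auto
  then have lo: "p \<le> - 1 \<longleftrightarrow> b + c \<le> a"
    using pos by (simp add: cosh_real_nonneg_le_iff)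
  have "1 \<le> p \<longleftrightarrow> cosh a \<le> cosh \<bar>b - c\<bar>"
    unfolding p_def pos_le_divide_eq[OF s] cosh_real_abs cosh_diff by auto
  then have hi: "1 \<le> p \<longleftrightarrow> a \<le> \<bar>b - c\<bar>"
    using pos by (simp add: cosh_real_nonneg_le_iff del: cosh_real_abs)
  show "tri_angle (cosh a) (cosh b) (cosh c) =
      (if b + c \<le> a then pi else if a \<le> \<bar>b - c\<bar> then 0 else arccos p)"
    unfolding tri_angle_def p lo[symmetric] hi[symmetric]
    by (auto simp: max_def min_def)
  have "1 < cosh b" "1 < cosh c"
    using pos cosh_real_nonneg_less_iff[of 0 b] cosh_real_nonneg_less_iff[of 0 c] by simp_all
  from abs_cos_less_1_iff[OF this, of "cosh a", unfolded p] lo hi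
  show "0 < gram (cosh a) (cosh b) (cosh c) \<longleftrightarrow> a < b + c \<and> \<bar>b - c\<bar> < a"
    by linarith
qed

lemma triple_permutation:
  assumes "{i, j, k} = {u, v, w}" "i \<noteq> j" "i \<noteq> k" "j \<noteq> k"
  shows "(u, v, w) \<in> {(i,j,k), (i,k,j), (j,i,k), (j,k,i), (k,i,j), (k,j,i)}"
proof -
  have "card {u, v, w} = 3" using assms by (simp flip: assms(1))
  then have "u \<noteq> v" "u \<noteq> w" "v \<noteq> w" by (auto simp: card_insert_if split: if_splits)
  moreover have "u \<in> {i, j, k}" "v \<in> {i, j, k}" "w \<in> {i, j, k}" using assms(1) by simp_all
  ultimately show ?thesis by auto
qed

text \<open>The definition quantifies over all six orderings of the vertices; up to the symmetry of edge
  lengths they give three inequalities.\<close>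

lemma nondegenerate_iff:
  fixes I :: "'n::finite set \<Rightarrow> real" and r :: "real^'n"
  assumes "i \<noteq> j" "i \<noteq> k" "j \<noteq> k"
  defines "a \<equiv> edge_length I r j k" and "b \<equiv> edge_length I r k i" and "c \<equiv> edge_length I r i j"
  shows "nondegenerate I r {i, j, k} \<longleftrightarrow> a < b + c \<and> b < c + a \<and> c < a + b"
proof
  assume "nondegenerate I r {i, j, k}"
  then have "edge_length I r v w < edge_length I r u v + edge_length I r u w"
    if "{i, j, k} = {u, v, w}" for u v w
    using that unfolding nondegenerate_def by blast
  from this[of i j k] this[of j k i] this[of k i j]
  show "a < b + c \<and> b < c + a \<and> c < a + b"
    by (auto simp: a_def b_def c_def edge_length_commute[of I r i k] edge_length_commute[of I r j i]
        edge_length_commute[of I r k j] insert_commute)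
next
  assume tri: "a < b + c \<and> b < c + a \<and> c < a + b"
  show "nondegenerate I r {i, j, k}"
    unfolding nondegenerate_def
  proof (intro allI impI)
    fix u v w assume "{i, j, k} = {u, v, w}"
    from triple_permutation[OF this assms(1-3)] tri
    show "edge_length I r v w < edge_length I r u v + edge_length I r u w"
      by (auto simp: a_def b_def c_def edge_length_commute[of I r i k] edge_length_commute[of I r j i]
        edge_length_commute[of I r k j])
  qed
qed

text \<open>The edges are listed in cyclic order, so that rotating \<open>i\<close>, \<open>j\<close>, \<open>k\<close> rotates the arguments of
  \<open>tri_angle\<close>, as in \<open>face_angles\<close>.\<close>

lemma gen_inner_angle_eq_tri_angle:
  fixes I :: "'n::finite set \<Rightarrow> real" and r :: "real^'n"
  assumes d: "i \<noteq> j" "i \<noteq> k" "j \<noteq> k"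
  defines "a \<equiv> edge_length I r j k" and "b \<equiv> edge_length I r k i" and "c \<equiv> edge_length I r i j"
  assumes pos: "0 < a" "0 < b" "0 < c"
  shows "gen_inner_angle I r {i, j, k} i = tri_angle (cosh a) (cosh b) (cosh c)"
proof (cases "nondegenerate I r {i, j, k}")
  case True
  then have "inner_angle I r {i, j, k} i =
      arccos ((cosh b * cosh c - cosh a) / (sinh b * sinh c))"
    using inner_angle_eq[OF refl d True] by (simp add: a_def b_def c_def edge_length_commute[of I r i k])
  moreover have "a < b + c" "\<bar>b - c\<bar> < a"
    using True nondegenerate_iff[OF d, of I r] by (auto simp: a_def b_def c_def)
  ultimately show ?thesis
    using True by (simp add: gen_inner_angle_def tri_angle_cosh(1)[OF pos])
next
  case False
  have "(\<exists>v w. {i, j, k} = {i, v, w} \<and>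
      edge_length I r v w \<ge> edge_length I r i v + edge_length I r i w) \<longleftrightarrow> b + c \<le> a" (is "?L \<longleftrightarrow> _")
  proof
    assume ?L
    then obtain v w where vw: "{i, j, k} = {i, v, w}"
      "edge_length I r v w \<ge> edge_length I r i v + edge_length I r i w" by blast
    from triple_permutation[OF vw(1) d] vw(2) d show "b + c \<le> a"
      by (auto simp: a_def b_def c_def edge_length_commute[of I r i k] edge_length_commute[of I r k j])
  next
    assume "b + c \<le> a"
    then show ?L
      by (intro exI[of _ j] exI[of _ k]) (simp add: a_def b_def c_def edge_length_commute[of I r i k])
  qed
  moreover have "b + c \<le> a \<or> a \<le> \<bar>b - c\<bar>"
    using False nondegenerate_iff[OF d, of I r] by (auto simp: a_def b_def c_def)
  ultimately show ?thesis
    using False by (auto simp: gen_inner_angle_def tri_angle_cosh(1)[OF pos])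
qed

lemma face_curvature_monotone:
  fixes r s :: "real^'n::finite"
  assumes r: "r \<in> pos_radii" and s: "s \<in> pos_radii" and f: "card f = 3"
    and I: "\<And>e. e \<subseteq> f \<Longrightarrow> card e = 2 \<Longrightarrow> 0 \<le> I e"
  defines "S \<equiv> \<Sum>i\<in>f. (dual_radius s i - dual_radius r i) * (gen_inner_angle I s f i - gen_inner_angle I r f i)"
  shows "0 \<le> S" and "nondegenerate I r f \<Longrightarrow> i \<in> f \<Longrightarrow> r $ i \<noteq> s $ i \<Longrightarrow> 0 < S"
proof -
  obtain u v w where uvw: "f = {u, v, w}" "u \<noteq> v" "u \<noteq> w" "v \<noteq> w"
    using f by (auto simp: card_3_iff)
  have d: "u \<noteq> v" "u \<noteq> w" "v \<noteq> w" "v \<noteq> u" "w \<noteq> u" "w \<noteq> v" using uvw by auto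
  have Ie: "0 \<le> I {v, w}" "0 \<le> I {w, u}" "0 \<le> I {u, v}"
    using uvw by (intro I; force)+
  define J :: "real^3" where "J = vector [I {v, w}, I {w, u}, I {u, v}]"
  define W :: "real^'n \<Rightarrow> real^3" where
    "W t = vector [dual_radius t u, dual_radius t v, dual_radius t w]" for t
  have J: "0 \<le> J $ i" for i
  proof -
    have "\<forall>i. 0 \<le> J $ i" using Ie by (simp add: forall_3 J_def)
    then show ?thesis ..
  qed
  have W: "0 < W t $ i" if "t \<in> pos_radii" for t i
  proof -
    have "\<forall>i. 0 < W t $ i" using dual_radius_pos[OF that] by (simp add: forall_3 W_def)
    then show ?thesis ..
  qed
  have rot: "f = {u, v, w}" "f = {v, w, u}" "f = {w, u, v}" using uvw by auto
  have cosh: "face_cosh J (W t) = vector [cosh (edge_length I t v w), cosh (edge_length I t w u),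
      cosh (edge_length I t u v)]" if "t \<in> pos_radii" for t
    by (simp add: face_cosh_def J_def W_def cosh_edge_length[OF that] Ie)
  have angles: "face_angles J (W t) = vector [gen_inner_angle I t f u, gen_inner_angle I t f v,
      gen_inner_angle I t f w]" if t: "t \<in> pos_radii" for t
  proof -
    note pos = cosh_edge_length(2)[where I = I, OF t]
    have "gen_inner_angle I t f u = tri_angle (cosh (edge_length I t v w))
        (cosh (edge_length I t w u)) (cosh (edge_length I t u v))"
      unfolding rot(1) by (rule gen_inner_angle_eq_tri_angle) (use d pos Ie in auto)
    moreover have "gen_inner_angle I t f v = tri_angle (cosh (edge_length I t w u))
        (cosh (edge_length I t u v)) (cosh (edge_length I t v w))"
      unfolding rot(2) by (rule gen_inner_angle_eq_tri_angle) (use d pos Ie in auto)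
    moreover have "gen_inner_angle I t f w = tri_angle (cosh (edge_length I t u v))
        (cosh (edge_length I t v w)) (cosh (edge_length I t w u))"
      unfolding rot(3) by (rule gen_inner_angle_eq_tri_angle) (use d pos Ie in auto)
    ultimately show ?thesis by (simp add: face_angles_def cosh[OF t])
  qed
  have S: "S = (W s - W r) \<bullet> (face_angles J (W s) - face_angles J (W r))"
    unfolding S_def angles[OF r] angles[OF s] inner_3 uvw(1) using d by (simp add: W_def)
  show "0 \<le> S" unfolding S by (rule face_angles_monotone(1)[OF J W[OF r] W[OF s]])
  assume nd: "nondegenerate I r f" and i: "i \<in> f" "r $ i \<noteq> s $ i"
  have "edge_length I r v w < edge_length I r w u + edge_length I r u v"
    "\<bar>edge_length I r w u - edge_length I r u v\<bar> < edge_length I r v w"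
    using nd nondegenerate_iff[OF d(1-3), of I r] unfolding uvw(1) by auto
  then have "0 < face_gram J (W r)"
    unfolding face_gram_def cosh[OF r] vector_3
    using cosh_edge_length(2)[where I = I, OF r] Ie by (subst tri_angle_cosh(2)) auto
  moreover have "W r \<noteq> W s"
  proof
    assume "W r = W s"
    then have "dual_radius r i = dual_radius s i"
      using i uvw(1) by (auto simp: W_def vec_eq_3)
    then show False using dual_radius_inj[OF r s] i(2) by blast
  qed
  ultimately show "0 < S" unfolding S by (rule face_angles_monotone(2)[OF J W[OF r] W[OF s]])
qed

text \<open>Exchanging the sums over vertices and faces expresses the pairing of the difference of the
  curvatures with the difference of the variables through the pairings on single faces.  All of
  these are nonnegative, and on a face with a vertex where \<open>r\<close> and \<open>s\<close> differ the pairing is positive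
  because that face is nondegenerate for \<open>r\<close>.\<close>

theorem ext_curvature_rigid:
  fixes r s :: "real^'n::finite"
  assumes card: "\<And>f. f \<in> F \<Longrightarrow> card f = 3" and cover: "\<Union>F = UNIV"
    and I: "\<And>f e. f \<in> F \<Longrightarrow> e \<subseteq> f \<Longrightarrow> card e = 2 \<Longrightarrow> 0 \<le> I e"
    and r: "r \<in> Omega F I" and s: "s \<in> pos_radii"
    and eq: "ext_curvature F I s = ext_curvature F I r"
  shows "s = r"
proof (rule ccontr)
  assume "s \<noteq> r"
  then obtain i where i: "r $ i \<noteq> s $ i" by (metis vec_eq_iff)
  have rp: "r \<in> pos_radii" and nd: "\<And>f. f \<in> F \<Longrightarrow> nondegenerate I r f"
    using r by (auto simp: Omega_def)
  let ?d = "\<lambda>i. dual_radius s i - dual_radius r i"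
  let ?g = "\<lambda>f i. gen_inner_angle I s f i - gen_inner_angle I r f i"
  have "i \<in> \<Union>F" unfolding cover by (rule UNIV_I)
  then obtain f where f: "f \<in> F" "i \<in> f" by (rule UnionE)
  have "0 < (\<Sum>f\<in>F. \<Sum>i\<in>f. ?d i * ?g f i)"
  proof (rule sum_pos2[OF finite f(1)])
    show "0 < (\<Sum>i\<in>f. ?d i * ?g f i)"
      by (rule face_curvature_monotone(2)[OF rp s card[OF f(1)] I[OF f(1)] nd[OF f(1)] f(2) i])
    show "0 \<le> (\<Sum>i\<in>h. ?d i * ?g h i)" if "h \<in> F" for h
      by (rule face_curvature_monotone(1)[OF rp s card[OF that] I[OF that]])
  qed
  also have "\<dots> = (\<Sum>f\<in>F. \<Sum>i\<in>{i \<in> UNIV. i \<in> f}. ?d i * ?g f i)" by simp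
  also have "\<dots> = (\<Sum>i\<in>UNIV. \<Sum>f\<in>{f \<in> F. i \<in> f}. ?d i * ?g f i)"
    by (rule sum.swap_restrict) auto
  also have "\<dots> = (\<Sum>i\<in>UNIV. ?d i * (\<Sum>f\<in>{f \<in> F. i \<in> f}. ?g f i))"
    by (simp add: sum_distrib_left)
  also have "\<dots> = 0"
  proof -
    have "ext_curvature F I s $ i = ext_curvature F I r $ i" for i by (simp add: eq)
    then have "(\<Sum>f\<in>{f \<in> F. i \<in> f}. ?g f i) = 0" for i
      by (simp add: ext_curvature_def sum_subtractf)
    then show ?thesis by simp
  qed
  finally show False by simp
qed

theorem theorem1p11:
  fixes M :: "'m topology"
    and E F :: "'n::finite set set"
    and I :: "'n set \<Rightarrow> real"
  assumes "closed_surface M"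
    and "surface_triangulation M E F"
    and "\<forall>e\<in>E. 0 \<le> I e"
  shows "(\<forall>Kbar \<in> curvature F I ` Omega F I.
            \<exists>!r. r \<in> pos_radii \<and> ext_curvature F I r = Kbar) \<and>
         (\<forall>r0 \<in> Omega F I. (\<forall>i. curvature F I r0 $ i = 0) \<longrightarrow>
            ext_curvature F I r0 = 0 \<and>
            (\<forall>r \<in> pos_radii. ext_curvature F I r = 0 \<longrightarrow> r = r0))"
proof -
  have card: "card f = 3" if "f \<in> F" for f
    using that assms(2) by (simp add: surface_triangulation_def)
  have cover: "\<Union>F = UNIV" using assms(2) by (simp add: surface_triangulation_def)
  have I: "0 \<le> I e" if "f \<in> F" "e \<subseteq> f" "card e = 2" for f e
    using that assms(2,3) by (auto simp: surface_triangulation_def)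
  have rigid: "s = r" if "r \<in> Omega F I" "s \<in> pos_radii" "ext_curvature F I s = ext_curvature F I r" for r s
    using ext_curvature_rigid[OF card cover I that] .
  have ext: "ext_curvature F I r = curvature F I r" if "r \<in> Omega F I" for r
    using that by (simp add: ext_curvature_def curvature_def gen_inner_angle_def Omega_def)
  have pos: "r \<in> pos_radii" if "r \<in> Omega F I" for r using that by (simp add: Omega_def)
  show ?thesis
  proof (intro conjI ballI impI)
    fix Kbar assume "Kbar \<in> curvature F I ` Omega F I"
    then obtain r where r: "r \<in> Omega F I" "Kbar = curvature F I r" by blast
    show "\<exists>!r. r \<in> pos_radii \<and> ext_curvature F I r = Kbar"
      by (rule ex1I[of _ r]) (use r rigid[OF r(1)] ext pos in auto)
  next
    fix r0 assume r0: "r0 \<in> Omega F I" and "\<forall>i. curvature F I r0 $ i = 0"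
    then show zero: "ext_curvature F I r0 = 0" by (simp add: ext vec_eq_iff)
    fix r assume "r \<in> pos_radii" "ext_curvature F I r = 0"
    then show "r = r0" using rigid[OF r0] zero by simp
  qed
qed

end
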